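(* Let $m\in\mathbb{N}$ and $A\subseteq\mathbb{N}^m$. The following two statements are equivalent. (1) There exist functions $\alpha_1,\ldots,\alpha_m:\mathcal{P}_f(\mathbb{N}^{\mathbb{N}})\to\mathbb{N}$ and $H_1,\ldots,H_m:\mathcal{P}_f(\mathbb{N}^{\mathbb{N}})\to\mathcal{P}_f(\mathbb{N})$ such that (a) if $F,G\in\mathcal{P}_f(\mathbb{N}^{\mathbb{N}})$ and $F\subsetneq G$, then for every $i\in\{1,\ldots,m\}$, $\max H_i(F)<\min H_i(G)$; and (b) whenever $n\in\mathbb{N}$ with $n\ge m$, $G_1\subsetneq G_2\subsetneq\cdots\subsetneq G_n$ in $\mathcal{P}_f(\mathbb{N}^{\mathbb{N}})$, $\beta_1<\beta_2<\cdots<\beta_m$ in $\mathcal{P}_f(\mathbb{N})$ with $\max\beta_m\le n$, and $f_i\in G_i$ for every $i\in\{1,\ldots,n\}$, one has $$\left(\sum_{i\in\beta_1}\Bigl(\alpha_1(G_i)+\sum_{t\in H_1(G_i)}f_i(t)\Bigr),\ldots,\sum_{i\in\beta_m}\Bigl(\alpha_m(G_i)+\sum_{t\in H_m(G_i)}f_i(t)\Bigr)\right)\in A.$$ (2) There exist idempotents $p_1,\ldots,p_m$ in $(\mathcal{J},+)$ such that $A\in\bigotimes_{i=1}^m p_i$.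
   Context: $\mathbb{N}$ is the set of positive integers; $\mathcal{P}_f(X)$ is the set of nonempty finite subsets of $X$; $\mathbb{N}^{\mathbb{N}}$ is the set of all functions $\mathbb{N}\to\mathbb{N}$. For $\beta,\gamma\in\mathcal{P}_f(\mathbb{N})$, $\beta<\gamma$ means $\max\beta<\min\gamma$. $\beta\mathbb{N}$ is the set of ultrafilters on $\mathbb{N}$, with the operation: $A\in p+q$ iff $\{x\in\mathbb{N}:-x+A\in q\}\in p$, where $-x+A=\{y\in\mathbb{N}:x+y\in A\}$. An ultrafilter $p$ is idempotent if $p+p=p$. A set $A\subseteq\mathbb{N}$ is a $J$-set if for every $F\in\mathcal{P}_f(\mathbb{N}^{\mathbb{N}})$ there exist $a\in\mathbb{N}$ and $\beta\in\mathcal{P}_f(\mathbb{N})$ such that $a+\sum_{t\in\beta}f(t)\in A$ for all $f\in F$. $\mathcal{J}=\{p\in\beta\mathbb{N}:\text{every }A\in p\text{ is a }J\text{-set}\}$; it is a two-sided ideal of $(\beta\mathbb{N},+)$. Tensor products: for ultrafilters $p_1,\ldots,p_k$ on $\mathbb{N}$, $\bigotimes_{i=1}^k p_i$ is the ultrafilter on $\mathbb{N}^k$ defined recursively by $\bigotimes_{i=1}^1p_i=p_1$, and, for $A\subseteq\mathbb{N}^{k+1}$, $A\in\bigotimes_{i=1}^{k+1}p_i$ iff $\{(x_1,\ldots,x_k)\in\mathbb{N}^k:\{x_{k+1}\in\mathbb{N}:(x_1,\ldots,x_{k+1})\in A\}\in p_{k+1}\}\in\bigotimes_{i=1}^kp_i$.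 *)

theory Defs
  imports "HOL-Library.FuncSet"
begin

abbreviation PN :: "nat set" where
  "PN \<equiv> {0<..}"

definition Pf :: "'a set \<Rightarrow> 'a set set" where
  "Pf X = {F. F \<subseteq> X \<and> finite F \<and> F \<noteq> {}}"

text \<open>
  The extensional function space makes two functions that agree on the positive
  integers equal, so that strict inclusion between finite sets of functions has
  its intended meaning.
\<close>

abbreviation NN :: "(nat \<Rightarrow> nat) set" where
  "NN \<equiv> PN \<rightarrow>\<^sub>E PN"

definition set_less :: "nat set \<Rightarrow> nat set \<Rightarrow> bool" where
  "set_less B C \<longleftrightarrow> Max B < Min C"

definition ultrafilter_on :: "'a set \<Rightarrow> 'a set set \<Rightarrow> bool" where
  "ultrafilter_on X p \<longleftrightarrow>
     p \<subseteq> Pow X \<and> X \<in> p \<and> {} \<notin> p \<and>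
     (\<forall>A\<in>p. \<forall>B\<in>p. A \<inter> B \<in> p) \<and>
     (\<forall>A\<in>p. \<forall>B. A \<subseteq> B \<and> B \<subseteq> X \<longrightarrow> B \<in> p) \<and>
     (\<forall>A. A \<subseteq> X \<longrightarrow> A \<in> p \<or> X - A \<in> p)"

definition betaN :: "nat set set set" where
  "betaN = {p. ultrafilter_on PN p}"

definition uf_plus :: "nat set set \<Rightarrow> nat set set \<Rightarrow> nat set set" where
  "uf_plus p q = {A. A \<subseteq> PN \<and> {x \<in> PN. {y \<in> PN. x + y \<in> A} \<in> q} \<in> p}"

definition uf_idempotent :: "nat set set \<Rightarrow> bool" where
  "uf_idempotent p \<longleftrightarrow> uf_plus p p = p"

definition J_set :: "nat set \<Rightarrow> bool" where
  "J_set A \<longleftrightarrow>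
     A \<subseteq> PN \<and>
     (\<forall>F \<in> Pf NN. \<exists>a \<in> PN. \<exists>\<beta> \<in> Pf PN. \<forall>f \<in> F. a + (\<Sum>t\<in>\<beta>. f t) \<in> A)"

definition J_ultra :: "nat set set set" where
  "J_ultra = {p \<in> betaN. \<forall>A \<in> p. J_set A}"

text \<open>Points of the \<open>k\<close>-th power of the positive integers are lists of length \<open>k\<close>.\<close>

definition PN_pow :: "nat \<Rightarrow> nat list set" where
  "PN_pow k = {xs. length xs = k \<and> set xs \<subseteq> PN}"

text \<open>
  \<open>tensor p k\<close> is the tensor product of \<open>p 1, \<dots>, p k\<close>. It is meaningful for \<open>k \<ge> 1\<close>
  only; the value at \<open>0\<close> is irrelevant.
\<close>

fun tensor :: "(nat \<Rightarrow> nat set set) \<Rightarrow> nat \<Rightarrow> nat list set set" where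
  "tensor p 0 = {}"
| "tensor p (Suc 0) = {A. A \<subseteq> PN_pow 1 \<and> {x \<in> PN. [x] \<in> A} \<in> p 1}"
| "tensor p (Suc (Suc k)) =
     {A. A \<subseteq> PN_pow (Suc (Suc k)) \<and>
         {xs \<in> PN_pow (Suc k). {y \<in> PN. xs @ [y] \<in> A} \<in> p (Suc (Suc k))} \<in> tensor p (Suc k)}"

end

theory Submission
  imports Defs "HOL-Library.Countable"
begin

text \<open>
  Idempotents yield functions: call a tuple good if membership in \<open>A\<close> holds for \<open>p\<close>-most of its
  continuations and its last entry lies in the set of \<open>x \<in> B\<close> with \<open>- x + B \<in> p\<^sub>k\<close>, where \<open>B\<close> is the
  set of good choices for that entry. Then \<open>p\<close>-most new entries and \<open>p\<close>-most increments of
  the last entry keep a tuple good. As members of \<open>p\<^sub>j\<close> are J-sets, \<open>\<alpha>\<^sub>j F\<close> and \<open>H\<^sub>j F\<close> can be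
  chosen, by recursion on the finite set \<open>F\<close>, so that the finitely many tuples built from
  chains below \<open>F\<close> stay good.

  Functions yield idempotents: for fixed \<open>j\<close>, the sums over chains strictly above \<open>F\<close> form a J-set
  \<open>T\<^sub>j F\<close>. By the Hales-Jewett theorem J-sets are partition regular, so the ultrafilters all of
  whose members are J-sets and which contain every \<open>T\<^sub>j F\<close> form a nonempty closed semigroup. An
  idempotent \<open>p\<^sub>j\<close> in it works, since any realized tuple ending at \<open>G\<close> can be continued
  by every element of \<open>T\<^sub>j G\<close>.
\<close>

section \<open>The Hales-Jewett theorem\<close>

definition words :: "'a set \<Rightarrow> nat \<Rightarrow> 'a list set" where
  "words A n = {w. length w = n \<and> set w \<subseteq> A}"

text \<open>Combinatorial lines, with \<open>None\<close> as the variable letter. It has to occur,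
  which later keeps the index set of variable positions nonempty.\<close>

definition varwords :: "'a set \<Rightarrow> nat \<Rightarrow> 'a option list set" where
  "varwords A n = {v. length v = n \<and> None \<in> set v \<and> set v \<subseteq> insert None (Some ` A)}"

definition inst :: "'a option list \<Rightarrow> 'a \<Rightarrow> 'a list" where
  "inst v x = map (case_option x id) v"

text \<open>Colours are natural numbers, so that a colouring whose values are lists of colours can
  be coded by \<open>to_nat\<close> and the property applied to it again.\<close>

definition HJ :: "'a set \<Rightarrow> bool" where
  "HJ A \<longleftrightarrow> (\<forall>C :: nat set. finite C \<longrightarrow>
     (\<exists>n. \<forall>c. (\<forall>w \<in> words A n. c w \<in> C) \<longrightarrow>
        (\<exists>v \<in> varwords A n. \<exists>y. \<forall>x \<in> A. c (inst v x) = y)))"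

lemma finite_words: "finite A \<Longrightarrow> finite (words A n)"
  using finite_lists_length_eq[of A n] by (simp add: words_def conj_commute)

lemma words_append: "u \<in> words A k \<Longrightarrow> w \<in> words A n \<Longrightarrow> u @ w \<in> words A (k + n)"
  by (auto simp: words_def)

lemma words_mono: "A \<subseteq> B \<Longrightarrow> words A n \<subseteq> words B n"
  by (auto simp: words_def)

lemma varwords_mono: "A \<subseteq> B \<Longrightarrow> varwords A n \<subseteq> varwords B n"
  by (auto simp: varwords_def)

lemma varwords_append:
  "u \<in> varwords A k \<Longrightarrow> w \<in> varwords A n \<Longrightarrow> u @ w \<in> varwords A (k + n)"
  by (auto simp: varwords_def)

lemma varwords_append_word:
  "u \<in> varwords A k \<Longrightarrow> w \<in> words A n \<Longrightarrow> u @ map Some w \<in> varwords A (k + n)"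
  by (auto simp: varwords_def words_def)

lemma word_append_varwords:
  "u \<in> words A k \<Longrightarrow> w \<in> varwords A n \<Longrightarrow> map Some u @ w \<in> varwords A (k + n)"
  by (auto simp: varwords_def words_def)

lemma inst_append: "inst (u @ v) x = inst u x @ inst v x"
  by (simp add: inst_def)

lemma inst_map_Some: "inst (map Some w) x = w"
  by (simp add: inst_def comp_def)

lemma inst_in_words: "v \<in> varwords A n \<Longrightarrow> x \<in> A \<Longrightarrow> inst v x \<in> words A n"
  by (fastforce simp: varwords_def words_def inst_def)

text \<open>Colour \<open>u\<close> by the list of all colours of \<open>u @ w\<close>, with
  \<open>w\<close> running over the finitely many words of length \<open>k\<close>. This is again a
  finite colouring, and on a line monochromatic for it the letter has no influence, whatever suffix
  \<open>w\<close> follows.\<close>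

lemma HJ_stable:
  assumes "HJ A" "finite B" "finite C"
  shows "\<exists>n. \<forall>c :: 'a list \<Rightarrow> nat. (\<forall>u \<in> words A n. \<forall>w \<in> words B k. c (u @ w) \<in> C) \<longrightarrow>
           (\<exists>v \<in> varwords A n. \<forall>x \<in> A. \<forall>x' \<in> A. \<forall>w \<in> words B k.
              c (inst v x @ w) = c (inst v x' @ w))"
proof -
  obtain ws where ws: "set ws = words B k"
    using finite_list[OF finite_words[OF assms(2)]] by blast
  define C' where "C' = to_nat ` {l. set l \<subseteq> C \<and> length l = length ws}"
  have C'_fin: "finite C'"
    unfolding C'_def using finite_lists_length_eq[OF assms(3)] by blast
  obtain n where n: "\<forall>c. (\<forall>w \<in> words A n. c w \<in> C') \<longrightarrow>
        (\<exists>v \<in> varwords A n. \<exists>y. \<forall>x \<in> A. c (inst v x) = y)"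
    using assms(1) C'_fin unfolding HJ_def by (elim allE[of _ C'] impE exE) simp_all
  show ?thesis
  proof (intro exI[of _ n] allI impI)
    fix c :: "'a list \<Rightarrow> nat"
    assume c: "\<forall>u \<in> words A n. \<forall>w \<in> words B k. c (u @ w) \<in> C"
    define c' where "c' u = to_nat (map (\<lambda>w. c (u @ w)) ws)" for u
    have "\<forall>u \<in> words A n. c' u \<in> C'"
      unfolding c'_def C'_def using c ws by (intro ballI imageI) auto
    from n[THEN spec, THEN mp, OF this] obtain v y where v: "v \<in> varwords A n" "\<forall>x \<in> A. c' (inst v x) = y"
      by blast
    have "c (inst v x @ w) = c (inst v x' @ w)" if "x \<in> A" "x' \<in> A" "w \<in> words B k" for x x' w
    proof -
      have "c' (inst v x) = c' (inst v x')" using v that by simp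
      then show ?thesis using that(3) ws by (auto simp: c'_def)
    qed
    with v(1) show "\<exists>v \<in> varwords A n. \<forall>x \<in> A. \<forall>x' \<in> A. \<forall>w \<in> words B k.
              c (inst v x @ w) = c (inst v x' @ w)" by blast
  qed
qed

text \<open>Colour focusing: \<open>k\<close> variable words that agree at \<open>a\<close> and are monochromatic on \<open>A\<close>
  in \<open>k\<close> different colours.\<close>

lemma HJ_focus:
  assumes "HJ A" "A \<noteq> {}" "finite A" "finite C"
  shows "\<exists>n. \<forall>c :: 'a list \<Rightarrow> nat. (\<forall>w \<in> words (insert a A) n. c w \<in> C) \<longrightarrow>
     (\<exists>v \<in> varwords (insert a A) n. \<exists>y. \<forall>x \<in> insert a A. c (inst v x) = y) \<or>
     (\<exists>f \<in> words (insert a A) n. \<exists>Y \<subseteq> C. card Y = k \<and>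
        (\<forall>y \<in> Y. \<exists>v \<in> varwords (insert a A) n. inst v a = f \<and> (\<forall>x \<in> A. c (inst v x) = y)))"
proof (induction k)
  case 0
  show ?case by (rule exI[of _ 0]) (auto simp: words_def)
next
  case (Suc k)
  let ?A = "insert a A"
  obtain n where n: "\<forall>c :: 'a list \<Rightarrow> nat. (\<forall>w \<in> words ?A n. c w \<in> C) \<longrightarrow>
     (\<exists>v \<in> varwords ?A n. \<exists>y. \<forall>x \<in> ?A. c (inst v x) = y) \<or>
     (\<exists>f \<in> words ?A n. \<exists>Y \<subseteq> C. card Y = k \<and>
        (\<forall>y \<in> Y. \<exists>v \<in> varwords ?A n. inst v a = f \<and> (\<forall>x \<in> A. c (inst v x) = y)))"
    using Suc.IH by (rule exE)
  have "finite ?A" using assms(3) by simp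
  from HJ_stable[OF assms(1) this assms(4), of n] obtain l where
    l: "\<forall>c :: 'a list \<Rightarrow> nat. (\<forall>u \<in> words A l. \<forall>w \<in> words ?A n. c (u @ w) \<in> C) \<longrightarrow>
           (\<exists>v \<in> varwords A l. \<forall>x \<in> A. \<forall>x' \<in> A. \<forall>w \<in> words ?A n.
              c (inst v x @ w) = c (inst v x' @ w))" by (rule exE)
  show ?case
  proof (intro exI[of _ "l + n"] allI impI)
    fix c :: "'a list \<Rightarrow> nat"
    assume c: "\<forall>w \<in> words ?A (l + n). c w \<in> C"
    have "\<forall>u \<in> words A l. \<forall>w \<in> words ?A n. c (u @ w) \<in> C"
      using c words_append[of _ ?A l] words_mono[of A ?A] by blast
    from l[THEN spec, THEN mp, OF this] obtain u where u: "u \<in> varwords A l"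
      and u_eq: "\<And>x x' w. x \<in> A \<Longrightarrow> x' \<in> A \<Longrightarrow> w \<in> words ?A n \<Longrightarrow> c (inst u x @ w) = c (inst u x' @ w)"
      by blast
    have u': "u \<in> varwords ?A l" using u varwords_mono[of A ?A l] by blast
    obtain x0 where x0: "x0 \<in> A" using assms(2) by blast
    have ux0: "inst u x0 \<in> words ?A l" using inst_in_words[OF u'] x0 by blast
    \<comment> \<open>The colouring that remains for suffixes after the line \<open>u\<close>. By
      \<open>u_eq\<close> any other letter of \<open>A\<close> in place of \<open>x0\<close> gives
      the same colours.\<close>
    define c' where "c' w = c (inst u x0 @ w)" for w
    have line: "map Some (inst u x0) @ v \<in> varwords ?A (l + n)"
      "\<forall>x \<in> ?A. c (inst (map Some (inst u x0) @ v) x) = y"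
      if "v \<in> varwords ?A n" "\<forall>x \<in> ?A. c' (inst v x) = y" for v y
      using word_append_varwords[OF ux0] that by (auto simp: inst_append inst_map_Some c'_def)
    have "\<forall>w \<in> words ?A n. c' w \<in> C"
      using c words_append[OF ux0] by (auto simp: c'_def)
    from n[THEN spec, THEN mp, OF this]
    show "(\<exists>v \<in> varwords ?A (l + n). \<exists>y. \<forall>x \<in> ?A. c (inst v x) = y) \<or>
     (\<exists>f \<in> words ?A (l + n). \<exists>Y \<subseteq> C. card Y = Suc k \<and>
        (\<forall>y \<in> Y. \<exists>v \<in> varwords ?A (l + n). inst v a = f \<and> (\<forall>x \<in> A. c (inst v x) = y)))"
    proof (elim disjE)
      assume "\<exists>v \<in> varwords ?A n. \<exists>y. \<forall>x \<in> ?A. c' (inst v x) = y"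
      then obtain v y where v: "v \<in> varwords ?A n" "\<forall>x \<in> ?A. c' (inst v x) = y"
        by (elim bexE exE)
      show ?thesis by (intro disjI1 bexI[OF _ line(1)[OF v]] exI[of _ y] line(2)[OF v])
    next
      assume "\<exists>f \<in> words ?A n. \<exists>Y \<subseteq> C. card Y = k \<and>
        (\<forall>y \<in> Y. \<exists>v \<in> varwords ?A n. inst v a = f \<and> (\<forall>x \<in> A. c' (inst v x) = y))"
      then obtain f Y where f: "f \<in> words ?A n" and Y: "Y \<subseteq> C" "card Y = k"
        and foc: "\<forall>y \<in> Y. \<exists>v \<in> varwords ?A n. inst v a = f \<and> (\<forall>x \<in> A. c' (inst v x) = y)"
        by (elim bexE exE conjE)
      show ?thesis
      \<comment> \<open>If the focus \<open>f\<close> has one of the focused colours, the line of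
        that colour is monochromatic at \<open>a\<close> as well. Otherwise the variable
        \<open>u\<close> followed by the fixed word \<open>f\<close> has the new colour
        \<open>c' f\<close> on \<open>A\<close>, and all lines prefixed by \<open>u\<close> meet at
        \<open>?f\<close>.\<close>
      proof (cases "c' f \<in> Y")
        case True
        then obtain v where "v \<in> varwords ?A n" "inst v a = f" "\<forall>x \<in> A. c' (inst v x) = c' f"
          using foc by blast
        then show ?thesis using line[of v "c' f"] by blast
      next
        case False
        let ?f = "inst u a @ f" and ?Y = "insert (c' f) Y"
        have "finite Y" using Y(1) assms(4) finite_subset by blast
        then have card: "card ?Y = Suc k" using False Y(2) by simp
        have sub: "?Y \<subseteq> C" using Y(1) c words_append[OF ux0 f] by (simp add: c'_def)
        have word: "?f \<in> words ?A (l + n)"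
          using words_append[OF inst_in_words[OF u'] f] by blast
        have focus: "\<exists>v \<in> varwords ?A (l + n). inst v a = ?f \<and> (\<forall>x \<in> A. c (inst v x) = y)"
          if yY: "y \<in> ?Y" for y
        proof (cases "y = c' f")
          case True
          have "\<forall>x \<in> A. c (inst (u @ map Some f) x) = y"
            using u_eq[OF _ x0 f] True by (simp add: inst_append inst_map_Some c'_def)
          then show ?thesis
            by (intro bexI[OF _ varwords_append_word[OF u' f]]) (simp add: inst_append inst_map_Some)
        next
          case False
          then obtain v where v: "v \<in> varwords ?A n" "inst v a = f" "\<forall>x \<in> A. c' (inst v x) = y"
            using foc yY by blast
          have "\<forall>x \<in> A. c (inst (u @ v) x) = y"
            using u_eq[OF _ x0 inst_in_words[OF v(1)]] v(3) by (simp add: inst_append c'_def)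
          then show ?thesis
            by (intro bexI[OF _ varwords_append[OF u' v(1)]]) (simp add: inst_append v(2))
        qed
        show ?thesis
          by (intro disjI2 bexI[OF _ word] exI[of _ ?Y] conjI ballI sub card focus)
      qed
    qed
  qed
qed

text \<open>Induction on the alphabet by colour focusing: \<open>card C + 1\<close> focused lines
  would need more colours than \<open>C\<close> has, so \<open>HJ_focus\<close> leaves only the
  monochromatic line.\<close>

theorem Hales_Jewett: "finite A \<Longrightarrow> HJ A"
proof (induction A rule: finite_induct)
  case empty
  show ?case unfolding HJ_def
    by (intro allI impI exI[of _ 1] bexI[of _ "[None]"]) (auto simp: varwords_def)
next
  case (insert a A)
  show ?case
  \<comment> \<open>Focusing needs a letter in the old alphabet; over a single letter every line is
    monochromatic.\<close>
  proof (cases "A = {}")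
    case True
    have "[None] \<in> varwords {a} 1" by (simp add: varwords_def)
    then show ?thesis unfolding HJ_def True
      by (intro allI impI exI[of _ 1] bexI[of _ "[None]"] exI[of _ "_ (inst [None] a)"]) simp_all
  next
    case False
    show ?thesis unfolding HJ_def
    proof (intro allI impI)
      fix C :: "nat set" assume C: "finite C"
      from HJ_focus[OF insert.IH False insert.hyps(1) C, of a "Suc (card C)"] obtain n where
        n: "\<forall>c :: 'a list \<Rightarrow> nat. (\<forall>w \<in> words (insert a A) n. c w \<in> C) \<longrightarrow>
         (\<exists>v \<in> varwords (insert a A) n. \<exists>y. \<forall>x \<in> insert a A. c (inst v x) = y) \<or>
         (\<exists>f \<in> words (insert a A) n. \<exists>Y \<subseteq> C. card Y = Suc (card C) \<and>
          (\<forall>y \<in> Y. \<exists>v \<in> varwords (insert a A) n. inst v a = f \<and> (\<forall>x \<in> A. c (inst v x) = y)))"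
        by (rule exE)
      have no_Y: "card Y \<noteq> Suc (card C)" if "Y \<subseteq> C" for Y
        using card_mono[OF C that] by simp
      show "\<exists>n. \<forall>c. (\<forall>w \<in> words (insert a A) n. c w \<in> C) \<longrightarrow>
        (\<exists>v \<in> varwords (insert a A) n. \<exists>y. \<forall>x \<in> insert a A. c (inst v x) = y)"
      proof (intro exI[of _ n] allI impI)
        fix c :: "'a list \<Rightarrow> nat"
        assume "\<forall>w \<in> words (insert a A) n. c w \<in> C"
        from n[THEN spec, THEN mp, OF this]
        show "\<exists>v \<in> varwords (insert a A) n. \<exists>y. \<forall>x \<in> insert a A. c (inst v x) = y"
          by (rule disjE) (use no_Y in blast)+
      qed
    qed
  qed
qed

section \<open>Partition regularity of J-sets\<close>

lemma J_set_mono: "J_set A \<Longrightarrow> A \<subseteq> B \<Longrightarrow> B \<subseteq> PN \<Longrightarrow> J_set B"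
  unfolding J_set_def by (meson order_trans subsetD)

lemma PfI: "F \<subseteq> X \<Longrightarrow> finite F \<Longrightarrow> F \<noteq> {} \<Longrightarrow> F \<in> Pf X"
  by (simp add: Pf_def)

lemma J_setD:
  "J_set A \<Longrightarrow> F \<in> Pf NN \<Longrightarrow> \<exists>a \<in> PN. \<exists>\<beta> \<in> Pf PN. \<forall>f \<in> F. a + (\<Sum>t\<in>\<beta>. f t) \<in> A"
  by (simp add: J_set_def)

lemma NN_pos: "f \<in> NN \<Longrightarrow> t > 0 \<Longrightarrow> f t > 0"
  by (auto simp: PiE_def Pi_def)

text \<open>The shifted functions \<open>t \<mapsto> f (t + k)\<close> push the index set beyond \<open>k\<close>.\<close>

lemma J_set_beyond:
  assumes "J_set A" "F \<in> Pf NN"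
  shows "\<exists>a \<in> PN. \<exists>\<beta> \<in> Pf PN. (\<forall>t \<in> \<beta>. k < t) \<and> (\<forall>f \<in> F. a + (\<Sum>t\<in>\<beta>. f t) \<in> A)"
proof -
  define s where "s f = restrict (\<lambda>t. f (t + k)) PN" for f :: "nat \<Rightarrow> nat"
  have "s f \<in> NN" if "f \<in> F" for f
  proof -
    have f: "f \<in> NN" using assms(2) that unfolding Pf_def by blast
    show ?thesis unfolding s_def by (simp add: restrict_PiE_iff NN_pos[OF f])
  qed
  then have "s ` F \<in> Pf NN"
    using assms(2) by (intro PfI image_subsetI) (simp_all add: Pf_def)
  from J_setD[OF assms(1) this] obtain a \<beta> where a: "a \<in> PN" and \<beta>: "\<beta> \<in> Pf PN"
    and *: "\<forall>f \<in> s ` F. a + (\<Sum>t\<in>\<beta>. f t) \<in> A" by (elim bexE)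
  show ?thesis
  proof (intro bexI[OF _ a] bexI[of _ "(\<lambda>t. t + k) ` \<beta>"] conjI ballI)
    show "(\<lambda>t. t + k) ` \<beta> \<in> Pf PN" using \<beta> by (auto simp: Pf_def)
    show "k < t" if "t \<in> (\<lambda>t. t + k) ` \<beta>" for t using that \<beta> by (auto simp: Pf_def)
    fix f assume "f \<in> F"
    have "(\<Sum>t\<in>(\<lambda>t. t + k) ` \<beta>. f t) = (\<Sum>t\<in>\<beta>. f (t + k))"
      by (subst sum.reindex) auto
    also have "\<dots> = (\<Sum>t\<in>\<beta>. s f t)"
      using \<beta> by (intro sum.cong) (auto simp: s_def Pf_def)
    finally show "a + (\<Sum>t\<in>(\<lambda>t. t + k) ` \<beta>. f t) \<in> A"
      using bspec[OF *, of "s f"] \<open>f \<in> F\<close> by simp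
  qed
qed

text \<open>Along a variable word \<open>v\<close> over a set of functions, the fixed letters contribute to the
  translation and the variable positions to the index set.\<close>

lemma sum_inst_split:
  fixes v :: "(nat \<Rightarrow> nat) option list" and n :: nat
  defines "S \<equiv> {i. i < length v \<and> v ! i = None}"
  assumes "finite \<beta>" "length v = n"
  shows "(\<Sum>t\<in>\<beta>. \<Sum>i<n. (inst v f ! i) (n * t + i)) =
     (\<Sum>t\<in>\<beta>. \<Sum>i\<in>{..<n} - S. (the (v ! i)) (n * t + i)) +
     (\<Sum>s\<in>(\<lambda>(t, i). n * t + i) ` (\<beta> \<times> S). f s)"
proof -
  have S: "S \<subseteq> {..<n}" using assms by auto
  have inj: "inj_on (\<lambda>(t, i). n * t + i) (\<beta> \<times> S)"
  proof (rule inj_onI, clarify)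
    fix t i t' i' assume "i \<in> S" "i' \<in> S" and eq: "n * t + i = n * t' + i'"
    then have i: "i < n" "i' < n" using S by auto
    have "t = (n * t + i) div n" "i = (n * t + i) mod n" using i by auto
    moreover have "t' = (n * t' + i') div n" "i' = (n * t' + i') mod n" using i by auto
    ultimately show "t = t' \<and> i = i'" using eq by metis
  qed
  have "(\<Sum>i<n. (inst v f ! i) (n * t + i)) =
      (\<Sum>i\<in>{..<n} - S. (the (v ! i)) (n * t + i)) + (\<Sum>i\<in>S. f (n * t + i))" for t
  proof -
    have "(\<Sum>i<n. (inst v f ! i) (n * t + i)) =
      (\<Sum>i\<in>{..<n} - S. (inst v f ! i) (n * t + i)) + (\<Sum>i\<in>S. (inst v f ! i) (n * t + i))"
      using S by (intro sum.subset_diff) auto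
    also have "(\<Sum>i\<in>S. (inst v f ! i) (n * t + i)) = (\<Sum>i\<in>S. f (n * t + i))"
      by (intro sum.cong) (auto simp: S_def inst_def)
    also have "(\<Sum>i\<in>{..<n} - S. (inst v f ! i) (n * t + i)) =
        (\<Sum>i\<in>{..<n} - S. (the (v ! i)) (n * t + i))"
      using assms(3) by (intro sum.cong) (auto simp: S_def inst_def)
    finally show ?thesis .
  qed
  then have "(\<Sum>t\<in>\<beta>. \<Sum>i<n. (inst v f ! i) (n * t + i)) =
     (\<Sum>t\<in>\<beta>. \<Sum>i\<in>{..<n} - S. (the (v ! i)) (n * t + i)) + (\<Sum>t\<in>\<beta>. \<Sum>i\<in>S. f (n * t + i))"
    by (simp add: sum.distrib)
  also have "(\<Sum>t\<in>\<beta>. \<Sum>i\<in>S. f (n * t + i)) = (\<Sum>s\<in>(\<lambda>(t, i). n * t + i) ` (\<beta> \<times> S). f s)"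
    by (subst sum.reindex[OF inj]) (simp add: sum.cartesian_product case_prod_unfold)
  finally show ?thesis .
qed

text \<open>Two families that defeat \<open>B1\<close> and \<open>B2\<close> are joined to one
  alphabet. Hales-Jewett for two colours gives \<open>n\<close>; each word of length
  \<open>n\<close> becomes a function, and one pair \<open>a\<close>, \<open>\<beta>\<close> serves
  all words. A line on which membership in \<open>B1\<close> is constant then yields a translation
  and an index set that contradict the choice of \<open>F1\<close> or of \<open>F2\<close>.\<close>

theorem J_set_Un:
  assumes "J_set (B1 \<union> B2)"
  shows "J_set B1 \<or> J_set B2"
proof (rule ccontr)
  assume neg: "\<not> (J_set B1 \<or> J_set B2)"
  have sub: "B1 \<subseteq> PN" "B2 \<subseteq> PN" using assms by (auto simp: J_set_def)
  obtain F1 where F1: "F1 \<in> Pf NN"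
    and no1: "\<And>a \<beta>. a \<in> PN \<Longrightarrow> \<beta> \<in> Pf PN \<Longrightarrow> \<exists>f \<in> F1. a + (\<Sum>t\<in>\<beta>. f t) \<notin> B1"
    using neg sub unfolding J_set_def by blast
  obtain F2 where F2: "F2 \<in> Pf NN"
    and no2: "\<And>a \<beta>. a \<in> PN \<Longrightarrow> \<beta> \<in> Pf PN \<Longrightarrow> \<exists>f \<in> F2. a + (\<Sum>t\<in>\<beta>. f t) \<notin> B2"
    using neg sub unfolding J_set_def by blast
  let ?F = "F1 \<union> F2"
  have F: "finite ?F" "?F \<noteq> {}" "?F \<subseteq> NN" using F1 F2 by (auto simp: Pf_def)
  have "HJ ?F" using Hales_Jewett F(1) by blast
  then have "\<exists>n. \<forall>c. (\<forall>w \<in> words ?F n. c w \<in> {0, 1 :: nat}) \<longrightarrow>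
        (\<exists>v \<in> varwords ?F n. \<exists>y. \<forall>x \<in> ?F. c (inst v x) = y)"
    unfolding HJ_def by (rule allE[of _ "{0, 1}"]) simp
  then obtain n where n: "\<forall>c. (\<forall>w \<in> words ?F n. c w \<in> {0, 1 :: nat}) \<longrightarrow>
        (\<exists>v \<in> varwords ?F n. \<exists>y. \<forall>x \<in> ?F. c (inst v x) = y)"
    by (rule exE)
  \<comment> \<open>Any colouring serves here: a variable word of length \<open>n\<close> exists and
    contains the variable, so \<open>n\<close> is not 0.\<close>
  have "\<exists>v. v \<in> varwords ?F n" using n[THEN spec[of _ "\<lambda>_. 0"]] by auto
  then have n0: "n > 0" by (auto simp: varwords_def)
  \<comment> \<open>Letter \<open>i\<close> is read at \<open>n * t + i\<close>, so that different
    pairs \<open>t\<close>, \<open>i\<close> use different arguments. They are positive because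
    \<open>t\<close> and \<open>n\<close> are.\<close>
  define g where "g w = restrict (\<lambda>t. \<Sum>i<n. (w ! i) (n * t + i)) PN" for w :: "(nat \<Rightarrow> nat) list"
  have "g w \<in> NN" if w: "w \<in> words ?F n" for w
  proof -
    have "0 < (\<Sum>i<n. (w ! i) (n * t + i))" if "t > 0" for t
    proof (rule sum_pos)
      fix i assume "i \<in> {..<n}"
      then have "w ! i \<in> set w" using w by (auto simp: words_def)
      then have "w ! i \<in> NN" using w F(3) by (auto simp: words_def)
      then show "0 < (w ! i) (n * t + i)" by (rule NN_pos) (use n0 that in simp)
    qed (use n0 in auto)
    then show ?thesis by (simp add: g_def)
  qed
  moreover obtain f0 where "f0 \<in> ?F" using F(2) by blast
  then have "replicate n f0 \<in> words ?F n" by (auto simp: words_def)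
  ultimately have "g ` words ?F n \<in> Pf NN"
    using finite_words[OF F(1)] by (intro PfI) auto
  from J_setD[OF assms this] obtain a \<beta> where a: "a \<in> PN" and \<beta>: "\<beta> \<in> Pf PN"
    and hit: "\<forall>h \<in> g ` words ?F n. a + (\<Sum>t\<in>\<beta>. h t) \<in> B1 \<union> B2" by (elim bexE)
  define c :: "(nat \<Rightarrow> nat) list \<Rightarrow> nat" where "c w = (if a + (\<Sum>t\<in>\<beta>. g w t) \<in> B1 then 0 else 1)" for w
  have "\<forall>w \<in> words ?F n. c w \<in> {0, 1}" by (simp add: c_def)
  from n[THEN spec, THEN mp, OF this] obtain v y
    where v: "v \<in> varwords ?F n" and y: "\<forall>x \<in> ?F. c (inst v x) = y" by (elim bexE exE)
  have len: "length v = n" using v by (simp add: varwords_def)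
  define S where "S = {i. i < length v \<and> v ! i = None}"
  define a' where "a' = a + (\<Sum>t\<in>\<beta>. \<Sum>i\<in>{..<n} - S. (the (v ! i)) (n * t + i))"
  define \<beta>' where "\<beta>' = (\<lambda>(t, i). n * t + i) ` (\<beta> \<times> S)"
  have a': "a' \<in> PN" using a by (simp add: a'_def)
  have "S \<noteq> {}" using v by (auto simp: S_def varwords_def in_set_conv_nth)
  moreover have "finite S" by (simp add: S_def)
  ultimately have \<beta>': "\<beta>' \<in> Pf PN"
    using \<beta> n0 by (auto simp: \<beta>'_def Pf_def)
  have eq: "a + (\<Sum>t\<in>\<beta>. g (inst v f) t) = a' + (\<Sum>t\<in>\<beta>'. f t)" for f
  proof -
    have "(\<Sum>t\<in>\<beta>. g (inst v f) t) = (\<Sum>t\<in>\<beta>. \<Sum>i<n. (inst v f ! i) (n * t + i))"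
      using \<beta> by (intro sum.cong) (auto simp: g_def Pf_def)
    also have "\<dots> = (\<Sum>t\<in>\<beta>. \<Sum>i\<in>{..<n} - S. (the (v ! i)) (n * t + i)) + (\<Sum>t\<in>\<beta>'. f t)"
      using sum_inst_split[of \<beta> v n f] \<beta> len by (simp add: S_def \<beta>'_def Pf_def)
    finally show ?thesis by (simp add: a'_def)
  qed
  have hit': "a' + (\<Sum>t\<in>\<beta>'. f t) \<in> B1 \<union> B2" if "f \<in> ?F" for f
    using hit[THEN bspec, OF imageI, OF inst_in_words[OF v that]] by (simp add: eq)
  have col: "(a' + (\<Sum>t\<in>\<beta>'. f t) \<in> B1) = (y = 0)" if "f \<in> ?F" for f
    using y that by (auto simp: c_def eq split: if_splits)
  show False
  proof (cases "y = 0")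
    case True
    then show False using col no1[OF a' \<beta>'] by blast
  next
    case False
    then have "\<forall>f \<in> ?F. a' + (\<Sum>t\<in>\<beta>'. f t) \<in> B2" using hit' col by blast
    then show False using no2[OF a' \<beta>'] by blast
  qed
qed

lemma J_set_Union:
  assumes "finite \<A>" "J_set (\<Union> \<A>)"
  shows "\<exists>A \<in> \<A>. J_set A"
  using assms
proof (induction \<A> rule: finite_induct)
  case empty
  have "(\<lambda>_\<in>PN. 1) \<in> NN" by (simp add: restrict_PiE_iff)
  then have "{\<lambda>_\<in>PN. 1} \<in> Pf NN" by (simp add: Pf_def)
  then show ?case using J_setD[OF empty, of "{\<lambda>_\<in>PN. 1}"] by auto
next
  case (insert A \<A>)
  then show ?case using J_set_Un[of A "\<Union> \<A>"] by auto
qed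

section \<open>Idempotents in closed semigroups of ultrafilters\<close>

text \<open>The intersection with \<open>X\<close> takes care of the empty subfamily, whose
  intersection is the whole type.\<close>

definition fip :: "'a set \<Rightarrow> 'a set set \<Rightarrow> bool" where
  "fip X \<F> \<longleftrightarrow> (\<forall>S \<subseteq> \<F>. finite S \<longrightarrow> X \<inter> \<Inter> S \<noteq> {})"

text \<open>A family maximal with the finite intersection property is an ultrafilter: a set that
  meets all its finite intersections can be added, so it is a member already. Zorn applies because a
  finite part of the union of a chain lies in one family of the chain.\<close>

lemma ultrafilter_extension:
  assumes "\<F> \<subseteq> Pow X" "fip X \<F>"
  shows "\<exists>p. ultrafilter_on X p \<and> \<F> \<subseteq> p"
proof -
  define Z where "Z = {\<G>. \<F> \<subseteq> \<G> \<and> \<G> \<subseteq> Pow X \<and> fip X \<G>}"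
  have "\<exists>M\<in>Z. \<forall>\<G>\<in>Z. M \<subseteq> \<G> \<longrightarrow> \<G> = M"
  proof (rule subset_Zorn_nonempty)
    show "Z \<noteq> {}" using assms by (auto simp: Z_def)
    fix \<C> assume C: "\<C> \<noteq> {}" "subset.chain Z \<C>"
    then have CZ: "\<C> \<subseteq> Z" by (simp add: subset_chain_def)
    have "X \<inter> \<Inter> S \<noteq> {}" if S: "S \<subseteq> \<Union> \<C>" "finite S" for S
    proof -
      obtain \<G> where "\<G> \<in> \<C>" "S \<subseteq> \<G>"
        using finite_subset_Union_chain[OF S(2,1) C] by blast
      then show ?thesis using CZ S(2) by (auto simp: Z_def fip_def)
    qed
    moreover have "\<F> \<subseteq> \<Union> \<C>" "\<Union> \<C> \<subseteq> Pow X" using CZ C(1) unfolding Z_def by blast+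
    ultimately show "\<Union> \<C> \<in> Z" by (simp add: Z_def fip_def)
  qed
  then obtain M where "M \<in> Z" and max: "\<And>\<G>. \<G> \<in> Z \<Longrightarrow> M \<subseteq> \<G> \<Longrightarrow> \<G> = M" by blast
  then have M: "\<F> \<subseteq> M" "M \<subseteq> Pow X" and ne: "\<And>S. S \<subseteq> M \<Longrightarrow> finite S \<Longrightarrow> X \<inter> \<Inter> S \<noteq> {}"
    by (auto simp: Z_def fip_def)
  have add: "A \<in> M" if "A \<subseteq> X" and A: "\<And>S. S \<subseteq> M \<Longrightarrow> finite S \<Longrightarrow> X \<inter> \<Inter> S \<inter> A \<noteq> {}" for A
  proof -
    have "X \<inter> \<Inter> S \<noteq> {}" if S: "S \<subseteq> insert A M" "finite S" for S
    proof -
      have "X \<inter> \<Inter> (S - {A}) \<inter> A \<noteq> {}" using S by (intro A) auto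
      then show ?thesis by blast
    qed
    then have "insert A M \<in> Z" using M that(1) by (auto simp: Z_def fip_def)
    then show ?thesis using max by blast
  qed
  have up: "A \<in> M" if "S \<subseteq> M" "finite S" "X \<inter> \<Inter> S \<subseteq> A" "A \<subseteq> X" for A S
  proof (rule add)
    fix T assume "T \<subseteq> M" "finite T"
    then have "X \<inter> \<Inter> (S \<union> T) \<noteq> {}" using ne[of "S \<union> T"] that by blast
    then show "X \<inter> \<Inter> T \<inter> A \<noteq> {}" using that(3) by blast
  qed (rule that)
  have compl: "A \<in> M \<or> X - A \<in> M" if "A \<subseteq> X" for A
  proof (rule disjCI)
    assume "X - A \<notin> M"
    show "A \<in> M"
    proof (rule add[OF that], rule notI)
      fix S assume S: "S \<subseteq> M" "finite S" "X \<inter> \<Inter> S \<inter> A = {}"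
      then have "X - A \<in> M" by (intro up[of S]) auto
      then show False using \<open>X - A \<notin> M\<close> by blast
    qed
  qed
  have "ultrafilter_on X M" unfolding ultrafilter_on_def
  proof (intro conjI ballI allI impI)
    show "X \<in> M" using up[of "{}" X] by simp
    show "{} \<notin> M" using ne[of "{{}}"] by auto
    show "A \<inter> B \<in> M" if "A \<in> M" "B \<in> M" for A B
      using up[of "{A, B}" "A \<inter> B"] that M(2) by auto
    show "B \<in> M" if "A \<in> M" "A \<subseteq> B \<and> B \<subseteq> X" for A B
      using up[of "{A}" B] that by auto
  qed (use M compl in auto)
  then show ?thesis using M by blast
qed

section \<open>Elementary properties of ultrafilters\<close>

lemma
  assumes "ultrafilter_on X p"
  shows uf_sub: "A \<in> p \<Longrightarrow> A \<subseteq> X"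
    and uf_UNIV: "X \<in> p"
    and uf_empty: "{} \<notin> p"
    and uf_Int: "A \<in> p \<Longrightarrow> B \<in> p \<Longrightarrow> A \<inter> B \<in> p"
    and uf_mono: "A \<in> p \<Longrightarrow> A \<subseteq> B \<Longrightarrow> B \<subseteq> X \<Longrightarrow> B \<in> p"
    and uf_cases: "A \<subseteq> X \<Longrightarrow> A \<in> p \<or> X - A \<in> p"
  using assms unfolding ultrafilter_on_def by blast+

lemma uf_compl_iff:
  assumes "ultrafilter_on X p" "A \<subseteq> X"
  shows "X - A \<in> p \<longleftrightarrow> A \<notin> p"
  using uf_cases[OF assms] uf_Int[OF assms(1), of A "X - A"] uf_empty[OF assms(1)] by auto

lemma uf_Inter:
  assumes "ultrafilter_on X p" "finite S" "S \<subseteq> p"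
  shows "X \<inter> \<Inter> S \<in> p"
  using assms(2,3)
proof (induction S rule: finite_induct)
  case empty
  then show ?case using uf_UNIV[OF assms(1)] by simp
next
  case (insert A S)
  then have "A \<inter> (X \<inter> \<Inter> S) \<in> p" using uf_Int[OF assms(1)] by blast
  then show ?case by (simp add: Int_left_commute)
qed

lemma uf_Int_iff:
  assumes "ultrafilter_on X p" "A \<subseteq> X" "B \<subseteq> X"
  shows "A \<inter> B \<in> p \<longleftrightarrow> A \<in> p \<and> B \<in> p"
  using uf_Int[OF assms(1)] uf_mono[OF assms(1), of "A \<inter> B"] assms(2,3) by blast

lemma uf_eqI:
  assumes "ultrafilter_on X p" "ultrafilter_on X q" "p \<subseteq> q"
  shows "p = q"
proof
  show "q \<subseteq> p"
  proof
    fix A assume A: "A \<in> q"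
    then have "A \<subseteq> X" using uf_sub[OF assms(2)] by blast
    then show "A \<in> p"
      using uf_compl_iff[OF assms(1)] uf_compl_iff[OF assms(2)] A assms(3) by blast
  qed
qed (rule assms(3))

lemma uf_fip: "ultrafilter_on X p \<Longrightarrow> \<F> \<subseteq> p \<Longrightarrow> fip X \<F>"
  unfolding fip_def using uf_Inter[of X p] uf_empty[of X p] by (metis order_trans)

section \<open>Addition of ultrafilters\<close>

abbreviation shift :: "nat \<Rightarrow> nat set \<Rightarrow> nat set" where
  "shift x A \<equiv> {y \<in> PN. x + y \<in> A}"

text \<open>The map on sets dual to right translation by \<open>q\<close>. It respects intersections
  and complements, which makes \<open>uf_plus p q\<close> an ultrafilter, and by
  \<open>uf_pre_plus\<close> it turns sums into compositions, which gives associativity.\<close>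

definition uf_pre :: "nat set set \<Rightarrow> nat set \<Rightarrow> nat set" where
  "uf_pre q A = {x \<in> PN. shift x A \<in> q}"

lemma uf_plus_iff: "A \<in> uf_plus p q \<longleftrightarrow> A \<subseteq> PN \<and> uf_pre q A \<in> p"
  by (simp add: uf_plus_def uf_pre_def)

lemma uf_pre_sub: "uf_pre q A \<subseteq> PN"
  by (auto simp: uf_pre_def)

lemma uf_pre_mono:
  assumes "ultrafilter_on PN q" "A \<subseteq> B"
  shows "uf_pre q A \<subseteq> uf_pre q B"
  unfolding uf_pre_def using uf_mono[OF assms(1), of "shift _ A" "shift _ B"] assms(2) by blast

lemma uf_pre_Int:
  assumes "ultrafilter_on PN q"
  shows "uf_pre q (A \<inter> B) = uf_pre q A \<inter> uf_pre q B"
proof -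
  have "shift x (A \<inter> B) = shift x A \<inter> shift x B" for x by auto
  then have "shift x (A \<inter> B) \<in> q \<longleftrightarrow> shift x A \<in> q \<and> shift x B \<in> q" for x
    using uf_Int_iff[OF assms, of "shift x A" "shift x B"] by auto
  then show ?thesis by (auto simp: uf_pre_def)
qed

lemma uf_pre_Compl:
  assumes "ultrafilter_on PN q"
  shows "uf_pre q (PN - A) = PN - uf_pre q A"
proof -
  have "shift x (PN - A) = PN - shift x A" for x by auto
  then have "shift x (PN - A) \<in> q \<longleftrightarrow> shift x A \<notin> q" for x
    using uf_compl_iff[OF assms, of "shift x A"] by auto
  then show ?thesis by (auto simp: uf_pre_def)
qed

lemma uf_plus_ultrafilter:
  assumes "ultrafilter_on PN p" "ultrafilter_on PN q"
  shows "ultrafilter_on PN (uf_plus p q)"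
  unfolding ultrafilter_on_def
proof (intro conjI ballI allI impI)
  show "uf_plus p q \<subseteq> Pow PN" by (auto simp: uf_plus_iff)
  have "shift x PN = PN" for x by auto
  then have "uf_pre q PN = PN" using uf_UNIV[OF assms(2)] by (auto simp: uf_pre_def)
  then show PN: "PN \<in> uf_plus p q" using uf_UNIV[OF assms(1)] by (simp add: uf_plus_iff)
  have "uf_pre q {} = {}" using uf_empty[OF assms(2)] by (auto simp: uf_pre_def)
  then show "{} \<notin> uf_plus p q" using uf_empty[OF assms(1)] by (simp add: uf_plus_iff)
  show "A \<inter> B \<in> uf_plus p q" if "A \<in> uf_plus p q" "B \<in> uf_plus p q" for A B
    using that uf_Int[OF assms(1)] by (auto simp: uf_plus_iff uf_pre_Int[OF assms(2)])
  show "B \<in> uf_plus p q" if "A \<in> uf_plus p q" "A \<subseteq> B \<and> B \<subseteq> PN" for A B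
    using that uf_mono[OF assms(1) _ uf_pre_mono[OF assms(2)] uf_pre_sub]
    by (auto simp: uf_plus_iff)
  show "A \<in> uf_plus p q \<or> PN - A \<in> uf_plus p q" if "A \<subseteq> PN" for A
    using uf_cases[OF assms(1) uf_pre_sub[of q A]] that
    by (auto simp: uf_plus_iff uf_pre_Compl[OF assms(2)])
qed

lemma uf_pre_plus: "uf_pre (uf_plus q r) A = uf_pre q (uf_pre r A)"
proof -
  have "shift x A \<in> uf_plus q r \<longleftrightarrow> shift x (uf_pre r A) \<in> q" if "x > 0" for x
  proof -
    have "shift y (shift x A) = shift (x + y) A" for y by (auto simp: add.assoc)
    then have "uf_pre r (shift x A) = shift x (uf_pre r A)"
      using that by (auto simp: uf_pre_def)
    then show ?thesis by (auto simp: uf_plus_iff)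
  qed
  then show ?thesis by (auto simp: uf_pre_def)
qed

lemma uf_plus_assoc: "uf_plus (uf_plus p q) r = uf_plus p (uf_plus q r)"
  by (auto simp: uf_plus_iff uf_pre_plus uf_pre_sub)

text \<open>Every closed subset of the Stone-Cech compactification has the form \<open>cl \<F>\<close>.\<close>

definition cl :: "nat set set \<Rightarrow> nat set set set" where
  "cl \<F> = {p \<in> betaN. \<F> \<subseteq> p}"

lemma cl_nonempty: "\<F> \<subseteq> Pow PN \<Longrightarrow> fip PN \<F> \<Longrightarrow> cl \<F> \<noteq> {}"
  using ultrafilter_extension[of \<F> PN] by (auto simp: cl_def betaN_def)

text \<open>Ellis-Numakura: a minimal nonempty closed subsemigroup \<open>C\<close> satisfies \<open>C + p = C\<close> and
  \<open>{q \<in> C. q + p = p} = C\<close> for every \<open>p \<in> C\<close>. Minimal \<open>C = cl \<F>\<close> are obtained from maximal \<open>\<F>\<close>.\<close>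

theorem idempotent_in_closed_semigroup:
  assumes sub: "\<F>\<^sub>0 \<subseteq> Pow PN" and ne: "cl \<F>\<^sub>0 \<noteq> {}"
    and semi: "\<And>p q. p \<in> cl \<F>\<^sub>0 \<Longrightarrow> q \<in> cl \<F>\<^sub>0 \<Longrightarrow> uf_plus p q \<in> cl \<F>\<^sub>0"
  shows "\<exists>p \<in> cl \<F>\<^sub>0. uf_idempotent p"
proof -
  \<comment> \<open>Larger families have smaller closures, so a maximal family gives a minimal
    closed semigroup.\<close>
  define Z where "Z = {\<F>. \<F>\<^sub>0 \<subseteq> \<F> \<and> \<F> \<subseteq> Pow PN \<and> cl \<F> \<noteq> {} \<and>
    (\<forall>p \<in> cl \<F>. \<forall>q \<in> cl \<F>. uf_plus p q \<in> cl \<F>)}"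
  have "\<exists>M\<in>Z. \<forall>\<G>\<in>Z. M \<subseteq> \<G> \<longrightarrow> \<G> = M"
  proof (rule subset_Zorn_nonempty)
    have "\<F>\<^sub>0 \<in> Z" using assms by (simp add: Z_def)
    then show "Z \<noteq> {}" by blast
    fix \<C> assume C: "\<C> \<noteq> {}" "subset.chain Z \<C>"
    then have CZ: "\<C> \<subseteq> Z" by (simp add: subset_chain_def)
    \<comment> \<open>Compactness: a finite part of the union lies in one family of the chain, and
      that family is contained in an ultrafilter.\<close>
    have "PN \<inter> \<Inter> S \<noteq> {}" if S: "S \<subseteq> \<Union> \<C>" "finite S" for S
    proof -
      obtain \<G> where G: "\<G> \<in> \<C>" "S \<subseteq> \<G>"
        using finite_subset_Union_chain[OF S(2,1) C] by blast
      then obtain p where "ultrafilter_on PN p" "\<G> \<subseteq> p"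
        using CZ by (auto simp: Z_def cl_def betaN_def)
      then have "fip PN \<G>" by (rule uf_fip)
      then show ?thesis using G S(2) by (simp add: fip_def)
    qed
    then have "fip PN (\<Union> \<C>)" by (simp add: fip_def)
    moreover have C_sub: "\<F>\<^sub>0 \<subseteq> \<Union> \<C>" "\<Union> \<C> \<subseteq> Pow PN"
      using CZ C(1) unfolding Z_def by blast+
    ultimately have "cl (\<Union> \<C>) \<noteq> {}" using cl_nonempty by blast
    moreover have "uf_plus p q \<in> cl (\<Union> \<C>)" if "p \<in> cl (\<Union> \<C>)" "q \<in> cl (\<Union> \<C>)" for p q
    proof -
      have eq: "cl (\<Union> \<C>) = (\<Inter>\<G>\<in>\<C>. cl \<G>)" using C(1) by (auto simp: cl_def)
      show ?thesis using that CZ unfolding eq by (auto simp: Z_def)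
    qed
    ultimately show "\<Union> \<C> \<in> Z" using C_sub by (simp add: Z_def)
  qed
  then obtain \<F> where "\<F> \<in> Z" and max: "\<And>\<G>. \<G> \<in> Z \<Longrightarrow> \<F> \<subseteq> \<G> \<Longrightarrow> \<G> = \<F>" by blast
  then have F: "\<F>\<^sub>0 \<subseteq> \<F>" "\<F> \<subseteq> Pow PN" "cl \<F> \<noteq> {}"
    and closed: "\<And>p q. p \<in> cl \<F> \<Longrightarrow> q \<in> cl \<F> \<Longrightarrow> uf_plus p q \<in> cl \<F>"
    by (auto simp: Z_def)
  obtain p where p: "p \<in> cl \<F>" using F(3) by blast
  have uf: "ultrafilter_on PN q" if "q \<in> cl \<F>" for q
    using that by (simp add: cl_def betaN_def)
  \<comment> \<open>\<open>cl \<G>\<close> is the translate \<open>cl \<F> + p\<close>: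
    \<open>plus_G\<close> shows one inclusion, \<open>G_plus\<close> the other.\<close>
  define \<G> where "\<G> = {A. \<forall>q \<in> cl \<F>. A \<in> uf_plus q p}"
  have G_sub: "\<G> \<subseteq> Pow PN" using p by (auto simp: \<G>_def uf_plus_iff)
  have FG: "\<F> \<subseteq> \<G>" using closed[OF _ p] by (auto simp: \<G>_def cl_def)
  have plus_G: "uf_plus q p \<in> cl \<G>" if "q \<in> cl \<F>" for q
    using closed[OF that p] that by (auto simp: \<G>_def cl_def)
  have G_plus: "\<exists>q \<in> cl \<F>. r = uf_plus q p" if r: "r \<in> cl \<G>" for r
  proof -
    have ufr: "ultrafilter_on PN r" using r by (simp add: cl_def betaN_def)
    \<comment> \<open>The wanted \<open>q\<close> has to contain \<open>\<F>\<close> and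
      \<open>uf_pre p A\<close> for all \<open>A\<close> in \<open>r\<close>; by compactness the
      finite intersection property suffices.\<close>
    define \<H> where "\<H> = \<F> \<union> uf_pre p ` r"
    have "PN \<inter> \<Inter> S \<noteq> {}" if S: "S \<subseteq> \<H>" "finite S" for S
    proof
      assume empty: "PN \<inter> \<Inter> S = {}"
      obtain R where R: "R \<subseteq> r" "finite R" "S - \<F> = uf_pre p ` R"
      proof -
        have "S - \<F> \<subseteq> uf_pre p ` r" "finite (S - \<F>)" using S by (auto simp: \<H>_def)
        from finite_subset_image[OF this(2,1)] show thesis by (elim exE conjE) (rule that)
      qed
      define A where "A = PN \<inter> \<Inter> R"
      have A: "A \<in> r" using uf_Inter[OF ufr R(2,1)] by (simp add: A_def)
      have preA: "uf_pre p A \<subseteq> uf_pre p B" if "B \<in> R" for B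
        using uf_pre_mono[OF uf[OF p]] that unfolding A_def by blast
      \<comment> \<open>As the intersection of \<open>S\<close> is empty, the members of
        \<open>S\<close> from \<open>\<F>\<close> have no common point in \<open>uf_pre p A\<close>.
        So every \<open>q + p\<close> contains the complement of \<open>A\<close>, and
        \<open>r\<close> would contain it too.\<close>
      have "PN - A \<in> uf_plus q p" if q: "q \<in> cl \<F>" for q
      proof -
        have "PN \<inter> \<Inter> (S \<inter> \<F>) \<in> q"
          using uf_Inter[OF uf[OF q]] q \<open>finite S\<close> by (auto simp: cl_def)
        moreover have "PN \<inter> \<Inter> (S \<inter> \<F>) \<subseteq> PN - uf_pre p A"
        proof -
          have "x \<in> \<Inter> S" if "x \<in> uf_pre p A" "x \<in> \<Inter> (S \<inter> \<F>)" for x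
          proof
            fix B assume "B \<in> S"
            show "x \<in> B"
            proof (cases "B \<in> \<F>")
              case False
              then obtain D where "D \<in> R" "B = uf_pre p D" using R(3) \<open>B \<in> S\<close> by blast
              then show ?thesis using preA that by blast
            qed (use that \<open>B \<in> S\<close> in blast)
          qed
          then show ?thesis using empty by blast
        qed
        ultimately have "PN - uf_pre p A \<in> q" using uf_mono[OF uf[OF q]] by blast
        then show ?thesis by (simp add: uf_plus_iff uf_pre_Compl[OF uf[OF p]])
      qed
      then have "PN - A \<in> r" using r by (auto simp: \<G>_def cl_def)
      then show False using A uf_compl_iff[OF ufr, of A] by (auto simp: A_def)
    qed
    moreover have "\<H> \<subseteq> Pow PN" using F(2) uf_pre_sub by (auto simp: \<H>_def)
    ultimately obtain q where q: "q \<in> betaN" "\<H> \<subseteq> q"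
      using cl_nonempty[of \<H>] by (auto simp: fip_def cl_def)
    then have "q \<in> cl \<F>" by (auto simp: cl_def \<H>_def)
    have "r \<subseteq> uf_plus q p"
      using q(2) uf_sub[OF ufr] by (auto simp: \<H>_def uf_plus_iff)
    then have "r = uf_plus q p"
      using uf_eqI[OF ufr uf_plus_ultrafilter[OF uf uf[OF p]]] \<open>q \<in> cl \<F>\<close> by blast
    then show ?thesis using \<open>q \<in> cl \<F>\<close> by blast
  qed
  \<comment> \<open>The translate is a semigroup because
    \<open>(q + p) + (q' + p) = ((q + p) + q') + p\<close>.\<close>
  have "\<G> \<in> Z"
  proof -
    have "uf_plus r r' \<in> cl \<G>" if r: "r \<in> cl \<G>" "r' \<in> cl \<G>" for r r'
    proof -
      obtain q q' where q: "q \<in> cl \<F>" "r = uf_plus q p" "q' \<in> cl \<F>" "r' = uf_plus q' p"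
        using G_plus r by blast
      then have "uf_plus r r' = uf_plus (uf_plus (uf_plus q p) q') p"
        by (simp add: uf_plus_assoc)
      then show ?thesis using plus_G closed p q by simp
    qed
    then show ?thesis using F(1) FG G_sub plus_G[OF p] by (auto simp: Z_def)
  qed
  then have "\<G> = \<F>" by (rule max[OF _ FG])
  then have "p \<in> cl \<G>" using p by simp
  then obtain q where q: "q \<in> cl \<F>" "uf_plus q p = p" using G_plus by metis
  \<comment> \<open>Describes the closed semigroup of those \<open>q\<close> in
    \<open>cl \<F>\<close> with \<open>q + p = p\<close>, nonempty by the first use of minimality.
    The second use makes it all of \<open>cl \<F>\<close>, so \<open>p\<close> itself belongs to
    it.\<close>
  define \<H> where "\<H> = \<F> \<union> uf_pre p ` p"
  have cl_H: "cl \<H> = {q \<in> cl \<F>. uf_plus q p = p}"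
  proof -
    have "uf_pre p ` p \<subseteq> q \<longleftrightarrow> uf_plus q p = p" if "q \<in> cl \<F>" for q
    proof
      assume "uf_pre p ` p \<subseteq> q"
      then have "p \<subseteq> uf_plus q p" using uf_sub[OF uf[OF p]] by (auto simp: uf_plus_iff)
      then show "uf_plus q p = p"
        using uf_eqI[OF uf[OF p] uf_plus_ultrafilter[OF uf[OF that] uf[OF p]]] by simp
    next
      assume "uf_plus q p = p"
      then show "uf_pre p ` p \<subseteq> q" using uf_plus_iff[of _ q p] by auto
    qed
    then show ?thesis by (auto simp: cl_def \<H>_def)
  qed
  have "\<H> \<in> Z"
  proof -
    have "uf_plus r r' \<in> cl \<H>" if "r \<in> cl \<H>" "r' \<in> cl \<H>" for r r'
      using that closed unfolding cl_H by (auto simp: uf_plus_assoc)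
    moreover have "\<H> \<subseteq> Pow PN" using F(2) uf_pre_sub by (auto simp: \<H>_def)
    moreover have "q \<in> cl \<H>" using q by (simp add: cl_H)
    moreover have "\<F>\<^sub>0 \<subseteq> \<H>" using F(1) by (auto simp: \<H>_def)
    ultimately show ?thesis unfolding Z_def by blast
  qed
  then have "\<H> = \<F>" using max by (auto simp: \<H>_def)
  then have "uf_plus p p = p" using cl_H p by blast
  then show ?thesis using p F(1) by (auto simp: cl_def uf_idempotent_def)
qed

section \<open>Idempotents consisting of J-sets, and tensor products\<close>

lemma J_ultraD: "p \<in> J_ultra \<Longrightarrow> ultrafilter_on PN p"
  by (simp add: J_ultra_def betaN_def)

text \<open>A member of \<open>p + q\<close> has a shift in \<open>q\<close>, which is a J-set; the
  amount of the shift is absorbed into the translation \<open>a\<close>.\<close>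

lemma J_ultra_plus:
  assumes "p \<in> J_ultra" "q \<in> J_ultra"
  shows "uf_plus p q \<in> J_ultra"
proof -
  have uf: "ultrafilter_on PN p" "ultrafilter_on PN q" using assms by (simp_all add: J_ultraD)
  have "J_set A" if A: "A \<in> uf_plus p q" for A
  proof -
    have "uf_pre q A \<noteq> {}" using A uf_empty[OF uf(1)] by (auto simp: uf_plus_iff)
    then obtain x where x: "x \<in> PN" "shift x A \<in> q" by (auto simp: uf_pre_def)
    then have J: "J_set (shift x A)" using assms(2) by (simp add: J_ultra_def)
    show ?thesis unfolding J_set_def
    proof (intro conjI ballI)
      show "A \<subseteq> PN" using A by (simp add: uf_plus_iff)
      fix F assume "F \<in> Pf NN"
      from J_setD[OF J this] obtain a \<beta> where a: "a \<in> PN" and \<beta>: "\<beta> \<in> Pf PN"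
        and *: "\<forall>f\<in>F. a + (\<Sum>t\<in>\<beta>. f t) \<in> shift x A" by (elim bexE)
      have "\<forall>f\<in>F. (x + a) + (\<Sum>t\<in>\<beta>. f t) \<in> A" using * by (simp add: add.assoc)
      moreover have "x + a \<in> PN" using a by simp
      ultimately show "\<exists>a\<in>PN. \<exists>\<beta>\<in>Pf PN. \<forall>f\<in>F. a + (\<Sum>t\<in>\<beta>. f t) \<in> A"
        using \<beta> by (intro bexI[of _ "x + a"] bexI[of _ \<beta>])
    qed
  qed
  then show ?thesis using uf_plus_ultrafilter[OF uf] by (simp add: J_ultra_def betaN_def)
qed

text \<open>The ultrafilters that contain every \<open>T i\<close>, and whose members are all
  J-sets, form a closed set. \<open>directed\<close> and partition regularity make it nonempty, and
  \<open>semi\<close> makes it a semigroup.\<close>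

theorem idempotent_in_J_ultra:
  fixes T :: "'i \<Rightarrow> nat set"
  assumes "I \<noteq> {}" and J: "\<And>i. i \<in> I \<Longrightarrow> J_set (T i)"
    and directed: "\<And>i j. i \<in> I \<Longrightarrow> j \<in> I \<Longrightarrow> \<exists>k \<in> I. T k \<subseteq> T i \<inter> T j"
    and semi: "\<And>i x. i \<in> I \<Longrightarrow> x \<in> T i \<Longrightarrow> \<exists>j \<in> I. \<forall>y \<in> T j. x + y \<in> T i"
  shows "\<exists>p \<in> J_ultra. uf_idempotent p \<and> (\<forall>i \<in> I. T i \<in> p)"
proof -
  define N where "N = {A. A \<subseteq> PN \<and> \<not> J_set A}"
  define \<F> where "\<F> = T ` I \<union> (\<lambda>A. PN - A) ` N"
  have T_sub: "T i \<subseteq> PN" if "i \<in> I" for i using J[OF that] by (simp add: J_set_def)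
  have F_sub: "\<F> \<subseteq> Pow PN" using T_sub by (auto simp: \<F>_def)
  have mem_cl: "p \<in> cl \<F> \<longleftrightarrow> p \<in> J_ultra \<and> (\<forall>i \<in> I. T i \<in> p)" for p
  proof -
    have "(\<lambda>A. PN - A) ` N \<subseteq> p \<longleftrightarrow> (\<forall>A \<in> p. J_set A)" if p: "p \<in> betaN"
    proof -
      have uf: "ultrafilter_on PN p" using p by (simp add: betaN_def)
      have "(\<lambda>A. PN - A) ` N \<subseteq> p \<longleftrightarrow> (\<forall>A \<in> N. A \<notin> p)"
        unfolding image_subset_iff N_def using uf_compl_iff[OF uf] by (intro ball_cong) auto
      also have "\<dots> \<longleftrightarrow> (\<forall>A \<in> p. J_set A)"
        using uf_sub[OF uf] by (auto simp: N_def)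
      finally show ?thesis .
    qed
    moreover have "p \<in> cl \<F> \<longleftrightarrow> p \<in> betaN \<and> (\<forall>i \<in> I. T i \<in> p) \<and> (\<lambda>A. PN - A) ` N \<subseteq> p"
      by (simp add: cl_def \<F>_def image_subset_iff)
    moreover have "p \<in> J_ultra \<longleftrightarrow> p \<in> betaN \<and> (\<forall>A \<in> p. J_set A)"
      by (simp add: J_ultra_def)
    ultimately show ?thesis by meson
  qed
  have lower: "\<exists>k \<in> I. \<forall>i \<in> K. T k \<subseteq> T i" if "finite K" "K \<subseteq> I" for K
    using that
  proof (induction K rule: finite_induct)
    case empty
    then show ?case using assms(1) by blast
  next
    case (insert i K)
    then obtain k where "k \<in> I" "\<forall>i \<in> K. T k \<subseteq> T i" by blast
    moreover obtain l where "l \<in> I" "T l \<subseteq> T k \<inter> T i"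
      using directed[of k i] \<open>k \<in> I\<close> insert.prems by blast
    ultimately show ?case by blast
  qed
  have "PN \<inter> \<Inter> S \<noteq> {}" if S: "S \<subseteq> \<F>" "finite S" for S
  proof
    assume empty: "PN \<inter> \<Inter> S = {}"
    have "S \<inter> T ` I \<subseteq> T ` I" "finite (S \<inter> T ` I)" using S by auto
    from finite_subset_image[OF this(2,1)] obtain K where
      K: "K \<subseteq> I" "finite K" "S \<inter> T ` I = T ` K" by (elim exE conjE)
    have "S - T ` I \<subseteq> (\<lambda>A. PN - A) ` N" "finite (S - T ` I)" using S by (auto simp: \<F>_def)
    from finite_subset_image[OF this(2,1)] obtain R where
      R: "R \<subseteq> N" "finite R" "S - T ` I = (\<lambda>A. PN - A) ` R" by (elim exE conjE)
    from lower[OF K(2,1)] obtain k where k: "k \<in> I" "\<forall>i \<in> K. T k \<subseteq> T i" by (elim bexE)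
    \<comment> \<open>An empty intersection would cover one \<open>T k\<close> by finitely many sets
      that are not J-sets, against partition regularity.\<close>
    have "T k \<subseteq> \<Union> R"
    proof
      fix x assume x: "x \<in> T k"
      then have "x \<in> PN" using T_sub k by blast
      then obtain B where "B \<in> S" "x \<notin> B" using empty by blast
      then have "B \<in> S - T ` I" using K(3) k(2) x by blast
      then show "x \<in> \<Union> R" using R(3) \<open>x \<notin> B\<close> \<open>x \<in> PN\<close> by blast
    qed
    moreover have "\<Union> R \<subseteq> PN" using R(1) by (auto simp: N_def)
    ultimately have "J_set (\<Union> R)" by (rule J_set_mono[OF J[OF k(1)]])
    from J_set_Union[OF R(2) this] obtain A where "A \<in> R" "J_set A" by (elim bexE)
    moreover from this have "A \<in> N" using R(1) by blast
    ultimately show False by (simp add: N_def)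
  qed
  then have ne: "cl \<F> \<noteq> {}" using cl_nonempty[OF F_sub] by (simp add: fip_def)
  have "uf_plus p q \<in> cl \<F>" if pq: "p \<in> cl \<F>" "q \<in> cl \<F>" for p q
  proof -
    have uf: "ultrafilter_on PN p" "ultrafilter_on PN q"
      using pq by (simp_all add: mem_cl J_ultraD)
    have "T i \<in> uf_plus p q" if i: "i \<in> I" for i
    proof -
      have "x \<in> uf_pre q (T i)" if x: "x \<in> T i" for x
      proof -
        from semi[OF i x] obtain j where j: "j \<in> I" "\<forall>y \<in> T j. x + y \<in> T i" by (elim bexE)
        then have "T j \<subseteq> shift x (T i)" using T_sub by blast
        moreover have "T j \<in> q" using pq j by (simp add: mem_cl)
        ultimately have "shift x (T i) \<in> q" using uf_mono[OF uf(2)] by blast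
        then show ?thesis using T_sub i x by (auto simp: uf_pre_def)
      qed
      then have "T i \<subseteq> uf_pre q (T i)" by blast
      moreover have "T i \<in> p" using pq(1) i by (simp add: mem_cl)
      ultimately have "uf_pre q (T i) \<in> p" using uf_mono[OF uf(1) _ _ uf_pre_sub] by blast
      then show ?thesis using T_sub i by (simp add: uf_plus_iff)
    qed
    then show ?thesis using pq J_ultra_plus by (simp add: mem_cl)
  qed
  from idempotent_in_closed_semigroup[OF F_sub ne this] show ?thesis
    by (auto simp: mem_cl)
qed

text \<open>Tensor membership unfolds to \<open>{x\<^sub>1. {x\<^sub>2. \<dots> [x\<^sub>1, \<dots>, x\<^sub>m] \<in> A \<dots>} \<in> p 2} \<in> p 1\<close>; in
  \<open>nested p A d xs\<close> the list \<open>xs\<close> holds the outer variables and \<open>d\<close> counts the inner ones.\<close>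

fun nested :: "(nat \<Rightarrow> nat set set) \<Rightarrow> nat list set \<Rightarrow> nat \<Rightarrow> nat list \<Rightarrow> bool" where
  "nested p A 0 xs \<longleftrightarrow> xs \<in> A"
| "nested p A (Suc d) xs \<longleftrightarrow> {y \<in> PN. nested p A d (xs @ [y])} \<in> p (Suc (length xs))"

text \<open>The recursion of \<open>tensor\<close> removes the innermost variable, that of
  \<open>nested\<close> the outermost. The inner induction shows that \<open>nested\<close> does not
  change when the last variable is absorbed into the set \<open>B\<close>.\<close>

lemma tensor_iff_nested:
  "A \<subseteq> PN_pow (Suc k) \<Longrightarrow> A \<in> tensor p (Suc k) \<longleftrightarrow> nested p A (Suc k) []"
proof (induction k arbitrary: A)
  case 0
  then show ?case by simp
next
  case (Suc k)
  define B where "B = {xs \<in> PN_pow (Suc k). {y \<in> PN. xs @ [y] \<in> A} \<in> p (Suc (Suc k))}"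
  have "nested p B d xs = nested p A (Suc d) xs" if "length xs + d = Suc k" "set xs \<subseteq> PN" for d xs
    using that
  proof (induction d arbitrary: xs)
    case 0
    then show ?case by (simp add: B_def PN_pow_def)
  next
    case (Suc d)
    have "{y \<in> PN. nested p B d (xs @ [y])} = {y \<in> PN. nested p A (Suc d) (xs @ [y])}"
      using Suc by (intro Collect_cong conj_cong) auto
    then show ?case by simp
  qed
  from this[of "[]" "Suc k"] have "nested p B (Suc k) [] = nested p A (Suc (Suc k)) []" by simp
  moreover have "B \<in> tensor p (Suc k) \<longleftrightarrow> nested p B (Suc k) []"
    by (rule Suc.IH) (auto simp: B_def)
  moreover have "A \<in> tensor p (Suc (Suc k)) \<longleftrightarrow> B \<in> tensor p (Suc k)"
    using Suc.prems by (simp add: B_def)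
  ultimately show ?case by blast
qed

section \<open>The star sets of an idempotent ultrafilter\<close>

definition star :: "nat set set \<Rightarrow> nat set \<Rightarrow> nat set" where
  "star p A = A \<inter> uf_pre p A"

lemma star_mem:
  assumes "ultrafilter_on PN p" "uf_idempotent p" "A \<in> p"
  shows "star p A \<in> p"
  using assms uf_plus_iff[of A p p] uf_Int[OF assms(1,3)] by (simp add: star_def uf_idempotent_def)

text \<open>\<open>star p\<close> commutes with shifts, and the shift of \<open>A\<close> by
  \<open>x\<close> is in \<open>p\<close>. Hence \<open>p\<close>-most increments of
  \<open>x\<close> stay in the star set, and the step can be repeated.\<close>

lemma shift_star_mem:
  assumes "ultrafilter_on PN p" "uf_idempotent p" "x \<in> star p A"
  shows "shift x (star p A) \<in> p"
proof -
  have "shift x A \<in> p" using assms(3) by (simp add: star_def uf_pre_def)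
  then have "star p (shift x A) \<in> p" by (rule star_mem[OF assms(1,2)])
  also have "star p (shift x A) = shift x (star p A)"
  proof -
    have "shift y (shift x A) = shift (x + y) A" for y by (auto simp: add.assoc)
    then show ?thesis by (auto simp: star_def uf_pre_def)
  qed
  finally show ?thesis .
qed

section \<open>Block systems from idempotents\<close>

definition block_val :: "nat \<Rightarrow> nat set \<Rightarrow> (nat \<Rightarrow> nat) \<Rightarrow> nat" where
  "block_val a h f = a + (\<Sum>t\<in>h. f t)"

definition preds :: "(nat \<Rightarrow> nat) set \<Rightarrow> (nat \<Rightarrow> nat) set set" where
  "preds F = {F' \<in> Pf NN. F' \<subset> F}"

lemma finite_preds: "F \<in> Pf NN \<Longrightarrow> finite (preds F)"
  by (rule finite_subset[of _ "Pow F"]) (auto simp: preds_def Pf_def)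

text \<open>The two ways in which a new chain member lets a tuple grow: it opens the next
  coordinate, or it joins the last block. A chain member that no block uses needs no third move,
  because later steps start from the tuples of all proper subsets.\<close>

definition moves :: "nat \<Rightarrow> (nat \<Rightarrow> nat) \<Rightarrow> (nat \<Rightarrow> nat set) \<Rightarrow> (nat \<Rightarrow> nat) \<Rightarrow> nat list \<Rightarrow> nat list set" where
  "moves m a h f xs =
     (if length xs < m then {xs @ [block_val (a (Suc (length xs))) (h (Suc (length xs))) f]} else {}) \<union>
     (if xs \<noteq> [] \<and> length xs \<le> m
      then {butlast xs @ [last xs + block_val (a (length xs)) (h (length xs)) f]} else {})"

text \<open>\<open>V F\<close> collects the tuples built from chains ending at \<open>F\<close>. It is finite, so the conditions on
  the values at \<open>F\<close> amount to hitting one member of \<open>p j\<close>.\<close>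

lemma exists_block_system:
  fixes p :: "nat \<Rightarrow> nat set set" and Good :: "nat list set"
  assumes J: "\<And>j. j \<in> {1..m} \<Longrightarrow> p j \<in> J_ultra"
    and Nil: "[] \<in> Good"
    and app: "\<And>xs. xs \<in> Good \<Longrightarrow> length xs < m \<Longrightarrow> {z \<in> PN. xs @ [z] \<in> Good} \<in> p (Suc (length xs))"
    and upd: "\<And>xs. xs \<in> Good \<Longrightarrow> xs \<noteq> [] \<Longrightarrow> length xs \<le> m \<Longrightarrow>
      {z \<in> PN. butlast xs @ [last xs + z] \<in> Good} \<in> p (length xs)"
  shows "\<exists>\<alpha> H V. \<forall>F \<in> Pf NN.
    (\<forall>j \<in> {1..m}. \<alpha> F j \<in> PN \<and> H F j \<in> Pf PN \<and> (\<forall>F' \<in> preds F. Max (H F' j) < Min (H F j))) \<and>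
    V F \<subseteq> Good \<and>
    (\<forall>xs \<in> insert [] (\<Union> (V ` preds F)). \<forall>f \<in> F. moves m (\<alpha> F) (H F) f xs \<subseteq> V F)"
proof -
  \<comment> \<open>The specification of one recursion step: \<open>r\<close> holds the values of
    \<open>\<alpha>\<close>, \<open>H\<close> and \<open>V\<close> at \<open>F\<close>, and
    \<open>v\<close> those at proper subsets. Finiteness of the third component is carried along for
    later steps.\<close>
  define P :: "((nat \<Rightarrow> nat) set \<Rightarrow> (nat \<Rightarrow> nat) \<times> (nat \<Rightarrow> nat set) \<times> nat list set) \<Rightarrow>
      (nat \<Rightarrow> nat) set \<Rightarrow> (nat \<Rightarrow> nat) \<times> (nat \<Rightarrow> nat set) \<times> nat list set \<Rightarrow> bool"
    where "P v F r \<longleftrightarrow> (F \<in> Pf NN \<longrightarrow>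
      (\<forall>j \<in> {1..m}. fst r j \<in> PN \<and> fst (snd r) j \<in> Pf PN \<and>
         (\<forall>F' \<in> preds F. Max (fst (snd (v F')) j) < Min (fst (snd r) j))) \<and>
      snd (snd r) \<subseteq> Good \<and> finite (snd (snd r)) \<and>
      (\<forall>xs \<in> insert [] (\<Union>F' \<in> preds F. snd (snd (v F'))). \<forall>f \<in> F.
         moves m (fst r) (fst (snd r)) f xs \<subseteq> snd (snd r)))" for v F r
  have "\<exists>v. \<forall>F. P v F (v F)"
  proof (rule dependent_wf_choice[OF wf_finite_psubset])
    fix v w :: "(nat \<Rightarrow> nat) set \<Rightarrow> (nat \<Rightarrow> nat) \<times> (nat \<Rightarrow> nat set) \<times> nat list set" and F r
    assume eq: "\<And>F'. (F', F) \<in> finite_psubset \<Longrightarrow> v F' = w F'"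
    show "P v F r = P w F r"
    proof (cases "F \<in> Pf NN")
      case True
      then have "v F' = w F'" if "F' \<in> preds F" for F'
        using that eq by (auto simp: preds_def Pf_def finite_psubset_def)
      then show ?thesis by (simp add: P_def)
    qed (simp add: P_def)
  next
    fix F v
    assume IH: "\<And>F'. (F', F) \<in> finite_psubset \<Longrightarrow> P v F' (v F')"
    show "\<exists>r. P v F r"
    proof (cases "F \<in> Pf NN")
      case F: True
      define W where "W = insert [] (\<Union>F' \<in> preds F. snd (snd (v F')))"
      have IH': "snd (snd (v F')) \<subseteq> Good \<and> finite (snd (snd (v F')))" if "F' \<in> preds F" for F'
      proof -
        have "P v F' (v F')" "F' \<in> Pf NN"
          using that F by (auto intro!: IH simp: preds_def Pf_def finite_psubset_def)
        then show ?thesis unfolding P_def by blast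
      qed
      have W: "finite W" "W \<subseteq> Good"
        using IH' finite_preds[OF F] Nil by (auto simp: W_def)
      have "\<exists>a \<beta>. a \<in> PN \<and> \<beta> \<in> Pf PN \<and>
          (\<forall>F' \<in> preds F. Max (fst (snd (v F')) j) < Min \<beta>) \<and>
          (\<forall>f \<in> F. \<forall>xs \<in> W.
             (Suc (length xs) = j \<longrightarrow> xs @ [block_val a \<beta> f] \<in> Good) \<and>
             (length xs = j \<longrightarrow> butlast xs @ [last xs + block_val a \<beta> f] \<in> Good))"
        if j: "j \<in> {1..m}" for j
      proof -
        \<comment> \<open>One set for each condition that a list in the finite set \<open>W\<close>
          imposes on coordinate \<open>j\<close>. All of them are in \<open>p j\<close>, so their
          intersection is a J-set.\<close>
        define S where "S = (\<lambda>xs. {z \<in> PN. xs @ [z] \<in> Good}) ` {xs \<in> W. Suc (length xs) = j} \<union>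
          (\<lambda>xs. {z \<in> PN. butlast xs @ [last xs + z] \<in> Good}) ` {xs \<in> W. length xs = j}"
        have "S \<subseteq> p j"
        proof -
          have "{z \<in> PN. xs @ [z] \<in> Good} \<in> p j" if "xs \<in> W" "Suc (length xs) = j" for xs
            using app[of xs] that W(2) j by auto
          moreover have "{z \<in> PN. butlast xs @ [last xs + z] \<in> Good} \<in> p j"
            if "xs \<in> W" "length xs = j" for xs
          proof -
            have "xs \<noteq> []" using that j by auto
            then show ?thesis using upd[of xs] that W(2) j by auto
          qed
          ultimately show ?thesis by (auto simp: S_def)
        qed
        moreover have "finite S" using W(1) by (simp add: S_def)
        ultimately have "PN \<inter> \<Inter> S \<in> p j" using uf_Inter[OF J_ultraD[OF J[OF j]]] by blast
        then have Jset: "J_set (PN \<inter> \<Inter> S)" using J[OF j] by (simp add: J_ultra_def)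
        \<comment> \<open>The sum bounds all the maxima at once, and it is 0 when there is no
          predecessor.\<close>
        define k where "k = (\<Sum>F' \<in> preds F. Max (fst (snd (v F')) j))"
        from J_set_beyond[OF Jset F, of k] obtain a \<beta> where a: "a \<in> PN" and \<beta>: "\<beta> \<in> Pf PN"
          and k: "\<forall>t \<in> \<beta>. k < t" and hit: "\<forall>f \<in> F. a + (\<Sum>t\<in>\<beta>. f t) \<in> PN \<inter> \<Inter> S"
          by (elim bexE conjE)
        have "Max (fst (snd (v F')) j) < Min \<beta>" if "F' \<in> preds F" for F'
        proof -
          have "Max (fst (snd (v F')) j) \<le> k"
            unfolding k_def using that finite_preds[OF F] by (intro member_le_sum) auto
          also have "k < Min \<beta>" using k \<beta> by (simp add: Pf_def)
          finally show ?thesis .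
        qed
        moreover have "xs @ [block_val a \<beta> f] \<in> Good"
          if "f \<in> F" "xs \<in> W" "Suc (length xs) = j" for f xs
        proof -
          have "{z \<in> PN. xs @ [z] \<in> Good} \<in> S" using that by (auto simp: S_def)
          then show ?thesis using bspec[OF hit that(1)] unfolding block_val_def by blast
        qed
        moreover have "butlast xs @ [last xs + block_val a \<beta> f] \<in> Good"
          if "f \<in> F" "xs \<in> W" "length xs = j" for f xs
        proof -
          have "{z \<in> PN. butlast xs @ [last xs + z] \<in> Good} \<in> S" using that by (auto simp: S_def)
          then show ?thesis using bspec[OF hit that(1)] unfolding block_val_def by blast
        qed
        ultimately show ?thesis using a \<beta> by (intro exI[of _ a] exI[of _ \<beta>] conjI ballI impI) simp_all
      qed
      then have "\<forall>j \<in> {1..m}. \<exists>a \<beta>. a \<in> PN \<and> \<beta> \<in> Pf PN \<and>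
          (\<forall>F' \<in> preds F. Max (fst (snd (v F')) j) < Min \<beta>) \<and>
          (\<forall>f \<in> F. \<forall>xs \<in> W.
             (Suc (length xs) = j \<longrightarrow> xs @ [block_val a \<beta> f] \<in> Good) \<and>
             (length xs = j \<longrightarrow> butlast xs @ [last xs + block_val a \<beta> f] \<in> Good))"
        by (rule ballI)
      from bchoice[OF this] obtain a where "\<forall>j \<in> {1..m}. \<exists>\<beta>. a j \<in> PN \<and> \<beta> \<in> Pf PN \<and>
          (\<forall>F' \<in> preds F. Max (fst (snd (v F')) j) < Min \<beta>) \<and>
          (\<forall>f \<in> F. \<forall>xs \<in> W.
             (Suc (length xs) = j \<longrightarrow> xs @ [block_val (a j) \<beta> f] \<in> Good) \<and>
             (length xs = j \<longrightarrow> butlast xs @ [last xs + block_val (a j) \<beta> f] \<in> Good))"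
        by (rule exE)
      from bchoice[OF this] obtain h where ah: "\<forall>j \<in> {1..m}. a j \<in> PN \<and> h j \<in> Pf PN \<and>
          (\<forall>F' \<in> preds F. Max (fst (snd (v F')) j) < Min (h j)) \<and>
          (\<forall>f \<in> F. \<forall>xs \<in> W.
             (Suc (length xs) = j \<longrightarrow> xs @ [block_val (a j) (h j) f] \<in> Good) \<and>
             (length xs = j \<longrightarrow> butlast xs @ [last xs + block_val (a j) (h j) f] \<in> Good))"
        by (rule exE)
      define V where "V = (\<Union>xs \<in> W. \<Union>f \<in> F. moves m a h f xs)"
      have "finite V" using W(1) F by (auto simp: V_def moves_def Pf_def)
      moreover have "moves m a h f xs \<subseteq> Good" if "xs \<in> W" "f \<in> F" for xs f
      proof -
        have "xs @ [block_val (a (Suc (length xs))) (h (Suc (length xs))) f] \<in> Good" if "length xs < m"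
          using bspec[OF ah, of "Suc (length xs)"] that \<open>xs \<in> W\<close> \<open>f \<in> F\<close> by simp
        moreover have "butlast xs @ [last xs + block_val (a (length xs)) (h (length xs)) f] \<in> Good"
          if "xs \<noteq> []" "length xs \<le> m"
          using bspec[OF ah, of "length xs"] that \<open>xs \<in> W\<close> \<open>f \<in> F\<close> by (simp add: Suc_le_eq)
        ultimately show ?thesis by (auto simp: moves_def)
      qed
      then have "V \<subseteq> Good" by (auto simp: V_def)
      moreover have "\<forall>xs \<in> W. \<forall>f \<in> F. moves m a h f xs \<subseteq> V" by (auto simp: V_def)
      ultimately have "P v F (a, h, V)"
        using ah unfolding P_def fst_conv snd_conv W_def[symmetric] by simp
      then show ?thesis ..
    qed (simp add: P_def)
  qed
  then obtain v where v: "\<And>F. P v F (v F)" by blast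
  show ?thesis
    by (rule exI[of _ "\<lambda>F. fst (v F)"], rule exI[of _ "\<lambda>F. fst (snd (v F))"],
        rule exI[of _ "\<lambda>F. snd (snd (v F))"]) (use v in \<open>simp add: P_def\<close>)
qed

section \<open>Tuples built along a chain\<close>

lemma chain_mono:
  fixes G :: "nat \<Rightarrow> 'a set"
  assumes "\<And>i. i \<in> {1..<n} \<Longrightarrow> G i \<subset> G (i + 1)" "1 \<le> i" "i < k" "k \<le> n"
  shows "G i \<subset> G k"
  using assms(3,4)
proof (induction k)
  case (Suc k)
  then have step: "G k \<subset> G (Suc k)" using assms(1)[of k] assms(2) by simp
  show ?case
  proof (cases "i = k")
    case False
    then have "G i \<subset> G k" using Suc by simp
    then show ?thesis using step by blast
  qed (use step in simp)
qed simp

lemma set_less_chain_mono: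
  fixes \<beta> :: "nat \<Rightarrow> nat set"
  assumes \<beta>: "\<And>j. j \<in> {1..m} \<Longrightarrow> \<beta> j \<in> Pf PN"
    and less: "\<And>j. j \<in> {1..<m} \<Longrightarrow> set_less (\<beta> j) (\<beta> (j + 1))"
    and "1 \<le> j" "j \<le> k" "k \<le> m"
  shows "Max (\<beta> j) \<le> Max (\<beta> k)"
  using assms(4,5)
proof (induction k)
  case 0
  then show ?case using assms(3) by simp
next
  case (Suc k)
  show ?case
  proof (cases "j = Suc k")
    case False
    then have "Max (\<beta> j) \<le> Max (\<beta> k)" using Suc by simp
    also have "\<dots> < Min (\<beta> (Suc k))" using less[of k] Suc.prems False assms(3) by (simp add: set_less_def)
    also have "\<dots> \<le> Max (\<beta> (Suc k))" using \<beta>[of "Suc k"] Suc.prems by (intro Min_le_iff[THEN iffD2] Max_ge) (auto simp: Pf_def)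
    finally show ?thesis by simp
  qed simp
qed

text \<open>Each index in a block is one move. After block \<open>j\<close> the list lies in
  \<open>V\<close> at the chain member with index \<open>Max (\<beta> j)\<close>, and this member is
  a predecessor of all those used by the next block.\<close>

lemma block_lists_in_V:
  fixes G :: "nat \<Rightarrow> (nat \<Rightarrow> nat) set"
  assumes V: "\<And>F xs f. F \<in> Pf NN \<Longrightarrow> xs \<in> insert [] (\<Union> (V ` preds F)) \<Longrightarrow> f \<in> F \<Longrightarrow>
      moves m (\<alpha> F) (H F) f xs \<subseteq> V F"
    and G: "\<And>i. i \<in> {1..n} \<Longrightarrow> G i \<in> Pf NN" "\<And>i. i \<in> {1..<n} \<Longrightarrow> G i \<subset> G (i + 1)"
    and \<beta>: "\<And>j. j \<in> {1..m} \<Longrightarrow> \<beta> j \<in> Pf PN"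
    and less: "\<And>j. j \<in> {1..<m} \<Longrightarrow> set_less (\<beta> j) (\<beta> (j + 1))"
    and max: "Max (\<beta> m) \<le> n"
    and f: "\<And>i. i \<in> {1..n} \<Longrightarrow> f i \<in> G i"
    and j: "1 \<le> j" "j \<le> m"
  shows "map (\<lambda>j. \<Sum>i\<in>\<beta> j. block_val (\<alpha> (G i) j) (H (G i) j) (f i)) [1..<j + 1] \<in> V (G (Max (\<beta> j)))"
proof -
  define val where "val j i = block_val (\<alpha> (G i) j) (H (G i) j) (f i)" for j i
  have pred: "G i \<in> preds (G k)" if "1 \<le> i" "i < k" "k \<le> n" for i k
    using chain_mono[of n G i k, OF G(2)] G(1)[of i] that by (simp add: preds_def)
  \<comment> \<open>One block, taken in increasing order: its least index appends an entry to
    \<open>xs\<close>, and each further index adds to that entry.\<close>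
  have block: "xs @ [\<Sum>i\<in>S. val (Suc (length xs)) i] \<in> V (G (Max S))"
    if "finite S" "S \<noteq> {}" "S \<subseteq> {1..n}" "length xs < m"
      "\<And>s. s \<in> S \<Longrightarrow> xs \<in> insert [] (\<Union> (V ` preds (G s)))" for S xs
    using that
  proof (induction S rule: finite_linorder_max_induct)
    case empty
    then show ?case by simp
  next
    case (insert b S)
    have b: "b \<in> {1..n}" using insert.prems by simp
    have Max: "Max (insert b S) = b"
      using insert.hyps by (intro Max_eqI) (auto intro: less_imp_le)
    show ?case
    proof (cases "S = {}")
      case True
      have "moves m (\<alpha> (G b)) (H (G b)) (f b) xs \<subseteq> V (G b)"
        using insert.prems by (intro V G f b) auto
      then show ?thesis using insert.prems True by (simp add: moves_def val_def)
    next
      case False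
      let ?ys = "xs @ [\<Sum>i\<in>S. val (Suc (length xs)) i]"
      have "?ys \<in> V (G (Max S))" using insert False by simp
      moreover have "Max S \<in> S" using False insert.hyps by simp
      then have "G (Max S) \<in> preds (G b)"
        using pred[of "Max S" b] insert.hyps insert.prems b by auto
      ultimately have "moves m (\<alpha> (G b)) (H (G b)) (f b) ?ys \<subseteq> V (G b)"
        by (intro V G f b) auto
      then have "xs @ [(\<Sum>i\<in>S. val (Suc (length xs)) i) + val (Suc (length xs)) b] \<in> V (G b)"
        using insert.prems by (simp add: moves_def val_def)
      moreover have "b \<notin> S" using insert.hyps by blast
      ultimately show ?thesis using insert.hyps by (simp add: Max add.commute)
    qed
  qed
  have \<beta>_sub: "\<beta> j \<subseteq> {1..n}" if "j \<in> {1..m}" for j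
  proof -
    have "Max (\<beta> j) \<le> Max (\<beta> m)"
      using that by (intro set_less_chain_mono[of m \<beta>] \<beta> less) auto
    then have "i \<le> n" if "i \<in> \<beta> j" for i
      using max Max_ge[of "\<beta> j" i] \<beta>[OF \<open>j \<in> {1..m}\<close>] that by (auto simp: Pf_def)
    then show ?thesis using \<beta>[OF that] by (fastforce simp: Pf_def)
  qed
  have "map (\<lambda>j. \<Sum>i\<in>\<beta> j. val j i) [1..<j + 1] \<in> V (G (Max (\<beta> j)))"
    using j
  proof (induction j)
    case 0
    then show ?case by simp
  next
    case (Suc j)
    let ?xs = "map (\<lambda>j. \<Sum>i\<in>\<beta> j. val j i) [1..<j + 1]"
    have S: "Suc j \<in> {1..m}" using Suc.prems by simp
    have "?xs \<in> insert [] (\<Union> (V ` preds (G s)))" if s: "s \<in> \<beta> (Suc j)" for s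
    proof (cases "j = 0")
      case False
      then have j: "j \<in> {1..m}" "j \<in> {1..<m}" using Suc.prems by simp_all
      have "Max (\<beta> j) \<in> \<beta> j" using \<beta>[OF j(1)] by (simp add: Pf_def)
      then have "1 \<le> Max (\<beta> j)" using \<beta>_sub[OF j(1)] by fastforce
      moreover have "Min (\<beta> (Suc j)) \<le> s" using \<beta>[OF S] s by (simp add: Pf_def)
      then have "Max (\<beta> j) < s" using less[OF j(2)] by (simp add: set_less_def)
      moreover have "s \<le> n" using \<beta>_sub[OF S] s by fastforce
      ultimately have "G (Max (\<beta> j)) \<in> preds (G s)" by (rule pred)
      then show ?thesis using Suc.IH Suc.prems False by auto
    qed simp
    then have "?xs @ [\<Sum>i\<in>\<beta> (Suc j). val (Suc (length ?xs)) i] \<in> V (G (Max (\<beta> (Suc j))))"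
      using \<beta>[OF S] \<beta>_sub[OF S] Suc.prems by (intro block) (auto simp: Pf_def)
    moreover have "length ?xs = j" by simp
    moreover have "[1..<Suc j + 1] = [1..<j + 1] @ [Suc j]" by simp
    ultimately show ?case by (simp only: map_append list.map)
  qed
  then show ?thesis by (simp add: val_def)
qed

section \<open>Idempotents from block systems\<close>

text \<open>The last member of the chain is recorded, so that another chain can be stacked above it.
  All members lie strictly above \<open>F\<close>.\<close>

inductive chain_sum ::
    "((nat \<Rightarrow> nat) set \<Rightarrow> nat) \<Rightarrow> ((nat \<Rightarrow> nat) set \<Rightarrow> nat set) \<Rightarrow>
     (nat \<Rightarrow> nat) set \<Rightarrow> (nat \<Rightarrow> nat) set \<Rightarrow> nat \<Rightarrow> bool"
  for a h F where
  single: "G \<in> Pf NN \<Longrightarrow> F \<subset> G \<Longrightarrow> f \<in> G \<Longrightarrow> chain_sum a h F G (block_val (a G) (h G) f)"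
| extend: "chain_sum a h F K x \<Longrightarrow> G \<in> Pf NN \<Longrightarrow> K \<subset> G \<Longrightarrow> f \<in> G \<Longrightarrow>
    chain_sum a h F G (x + block_val (a G) (h G) f)"

definition tails :: "((nat \<Rightarrow> nat) set \<Rightarrow> nat) \<Rightarrow> ((nat \<Rightarrow> nat) set \<Rightarrow> nat set) \<Rightarrow>
    (nat \<Rightarrow> nat) set \<Rightarrow> nat set" where
  "tails a h F = {x. \<exists>K. chain_sum a h F K x}"

lemma chain_sum_last: "chain_sum a h F K x \<Longrightarrow> K \<in> Pf NN \<and> F \<subset> K"
  by (induction rule: chain_sum.induct) auto

lemma chain_sum_antimono: "chain_sum a h F K x \<Longrightarrow> F' \<subseteq> F \<Longrightarrow> chain_sum a h F' K x"
  by (induction rule: chain_sum.induct) (blast intro: chain_sum.intros)+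

text \<open>A chain above \<open>K\<close> is stacked on a chain that ends at
  \<open>K\<close>.\<close>

lemma chain_sum_add:
  assumes "chain_sum a h K L y" "chain_sum a h F K x"
  shows "chain_sum a h F L (x + y)"
  using assms
proof (induction rule: chain_sum.induct)
  case (single G f)
  then show ?case by (blast intro: chain_sum.extend)
next
  case (extend M y G f)
  then show ?case unfolding add.assoc[symmetric] by (blast intro: chain_sum.extend)
qed

text \<open>Ensures that every finite set of functions has a strictly larger one, so that chains can
  be continued.\<close>

lemma infinite_NN: "infinite NN"
proof
  assume "finite NN"
  moreover have "(\<lambda>_\<in>PN. Suc c) \<in> NN" for c by (simp add: restrict_PiE_iff)
  then have "range (\<lambda>c. \<lambda>_\<in>PN. Suc c) \<subseteq> NN" by blast
  ultimately have "finite (range (\<lambda>c. \<lambda>_\<in>PN. Suc c))" by (rule rev_finite_subset)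
  moreover have "inj (\<lambda>c. \<lambda>_\<in>PN. Suc c)"
  proof (rule injI)
    fix c d assume "(\<lambda>_\<in>PN. Suc c) = (\<lambda>_\<in>PN. Suc d)"
    then have "(\<lambda>_\<in>PN. Suc c) 1 = (\<lambda>_\<in>PN. Suc d) 1" by (rule arg_cong)
    then show "c = d" by simp
  qed
  ultimately show False using finite_imageD infinite_UNIV_nat by blast
qed

text \<open>A chain with a single member is enough: \<open>G\<close> contains \<open>F\<close> and
  the given family \<open>F'\<close>, and a further function \<open>g\<close> outside
  \<open>F\<close> makes the inclusion strict. The block value at \<open>G\<close> then treats all
  of \<open>F'\<close> at once.\<close>

lemma J_set_tails:
  assumes ah: "\<And>G. G \<in> Pf NN \<Longrightarrow> a G \<in> PN \<and> h G \<in> Pf PN" and F: "F \<in> Pf NN"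
  shows "J_set (tails a h F)"
  unfolding J_set_def
proof (intro conjI ballI)
  have "x \<in> PN" if "chain_sum a h F K x" for K x
    using that by (induction rule: chain_sum.induct) (auto simp: block_val_def dest: ah)
  then show "tails a h F \<subseteq> PN" by (auto simp: tails_def)
  fix F' assume F': "F' \<in> Pf NN"
  have "finite F" using F by (simp add: Pf_def)
  then obtain g where g: "g \<in> NN" "g \<notin> F" using infinite_NN by (meson finite_subset subsetI)
  define G where "G = insert g (F \<union> F')"
  have G: "G \<in> Pf NN" "F \<subset> G" using g F F' unfolding G_def Pf_def by blast+
  have "\<forall>f \<in> F'. a G + (\<Sum>t\<in>h G. f t) \<in> tails a h F"
  proof
    fix f assume "f \<in> F'"
    then have "chain_sum a h F G (block_val (a G) (h G) f)"
      using G by (intro chain_sum.single) (auto simp: G_def)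
    then show "a G + (\<Sum>t\<in>h G. f t) \<in> tails a h F"
      unfolding tails_def block_val_def by blast
  qed
  then show "\<exists>x\<in>PN. \<exists>\<beta>\<in>Pf PN. \<forall>f\<in>F'. x + (\<Sum>t\<in>\<beta>. f t) \<in> tails a h F"
    using ah[OF G(1)] by (intro bexI[of _ "a G"] bexI[of _ "h G"]) auto
qed

text \<open>The tails are directed because those of \<open>F \<union> G\<close> lie in both others.
  They satisfy the semigroup condition because a sum whose chain ends at \<open>K\<close> can be
  followed by any element of the tails of \<open>K\<close>.\<close>

lemma idempotent_tails:
  assumes ah: "\<And>G. G \<in> Pf NN \<Longrightarrow> a G \<in> PN \<and> h G \<in> Pf PN"
  shows "\<exists>p \<in> J_ultra. uf_idempotent p \<and> (\<forall>F \<in> Pf NN. tails a h F \<in> p)"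
proof (rule idempotent_in_J_ultra)
  obtain g where "g \<in> NN" using infinite_NN by (meson finite.emptyI finite_subset subsetI)
  then have "{g} \<in> Pf NN" by (intro PfI) auto
  then show "Pf NN \<noteq> {}" by blast
  show "J_set (tails a h F)" if "F \<in> Pf NN" for F
    using that ah by (intro J_set_tails)
  show "\<exists>K \<in> Pf NN. tails a h K \<subseteq> tails a h F \<inter> tails a h G" if "F \<in> Pf NN" "G \<in> Pf NN" for F G
  proof
    show "F \<union> G \<in> Pf NN" using that unfolding Pf_def by blast
    have "tails a h (F \<union> G) \<subseteq> tails a h F" "tails a h (F \<union> G) \<subseteq> tails a h G"
      unfolding tails_def by (blast intro: chain_sum_antimono[of _ _ "F \<union> G"])+
    then show "tails a h (F \<union> G) \<subseteq> tails a h F \<inter> tails a h G" by blast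
  qed
  show "\<exists>K \<in> Pf NN. \<forall>y \<in> tails a h K. x + y \<in> tails a h F" if x: "x \<in> tails a h F" for F x
  proof -
    obtain K where K: "chain_sum a h F K x" using x by (auto simp: tails_def)
    have "\<forall>y \<in> tails a h K. x + y \<in> tails a h F"
      unfolding tails_def using chain_sum_add[OF _ K] by blast
    then show ?thesis using chain_sum_last[OF K] by blast
  qed
qed

section \<open>Tuples realized along finite chains\<close>

lemma set_less_iff: "B \<in> Pf PN \<Longrightarrow> C \<in> Pf PN \<Longrightarrow> set_less B C \<longleftrightarrow> (\<forall>b\<in>B. \<forall>c\<in>C. b < c)"
  by (auto simp: set_less_def Pf_def)

definition tuple :: "(nat \<Rightarrow> (nat \<Rightarrow> nat) set \<Rightarrow> nat) \<Rightarrow> (nat \<Rightarrow> (nat \<Rightarrow> nat) set \<Rightarrow> nat set) \<Rightarrow>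
    nat \<Rightarrow> (nat \<Rightarrow> (nat \<Rightarrow> nat) set) \<Rightarrow> (nat \<Rightarrow> nat set) \<Rightarrow> (nat \<Rightarrow> nat \<Rightarrow> nat) \<Rightarrow> nat list" where
  "tuple \<alpha> H k G \<beta> f = map (\<lambda>j. \<Sum>i\<in>\<beta> j. block_val (\<alpha> j (G i)) (H j (G i)) (f i)) [1..<k + 1]"

text \<open>The chain starts at \<open>G 0\<close>, which no block uses, so that the empty tuple is covered.\<close>

definition realizes :: "nat \<Rightarrow> nat \<Rightarrow> (nat \<Rightarrow> (nat \<Rightarrow> nat) set) \<Rightarrow> (nat \<Rightarrow> nat set) \<Rightarrow> (nat \<Rightarrow> nat \<Rightarrow> nat) \<Rightarrow> bool" where
  "realizes k n G \<beta> f \<longleftrightarrow>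
     (\<forall>i \<le> n. G i \<in> Pf NN) \<and> (\<forall>i < n. G i \<subset> G (Suc i)) \<and> (\<forall>i \<in> {1..n}. f i \<in> G i) \<and>
     (\<forall>j \<in> {1..k}. \<beta> j \<in> Pf PN \<and> \<beta> j \<subseteq> {1..n}) \<and>
     (\<forall>j \<in> {1..<k}. set_less (\<beta> j) (\<beta> (Suc j)))"

text \<open>Only the end \<open>K\<close> of the chain is remembered, since an extension just has to
  lie strictly above it.\<close>

definition realizable :: "(nat \<Rightarrow> (nat \<Rightarrow> nat) set \<Rightarrow> nat) \<Rightarrow> (nat \<Rightarrow> (nat \<Rightarrow> nat) set \<Rightarrow> nat set) \<Rightarrow>
    nat \<Rightarrow> (nat \<Rightarrow> nat) set \<Rightarrow> nat list \<Rightarrow> bool" where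
  "realizable \<alpha> H k K xs \<longleftrightarrow>
     (\<exists>n G \<beta> f. realizes k n G \<beta> f \<and> G n = K \<and> xs = tuple \<alpha> H k G \<beta> f)"

lemma realizable_Nil: "K \<in> Pf NN \<Longrightarrow> realizable \<alpha> H 0 K []"
  unfolding realizable_def realizes_def tuple_def
  by (intro exI[of _ 0] exI[of _ "\<lambda>_. K"]) simp

text \<open>All blocks lie in \<open>{1..n}\<close>, so changing the chain beyond \<open>n\<close>
  leaves the coordinates alone.\<close>

lemma tuple_cong:
  assumes "realizes k n G \<beta> f" "k' \<le> k"
    and "\<And>i. i \<le> n \<Longrightarrow> G' i = G i" "\<And>i. i \<le> n \<Longrightarrow> f' i = f i" "\<And>j. j \<le> k' \<Longrightarrow> \<beta>' j = \<beta> j"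
  shows "tuple \<alpha> H k' G' \<beta>' f' = tuple \<alpha> H k' G \<beta> f"
  unfolding tuple_def
proof (rule map_cong[OF refl])
  fix j assume "j \<in> set [1..<k' + 1]"
  then have j: "1 \<le> j" "j \<le> k'" by auto
  then have "\<beta> j \<subseteq> {1..n}" using assms(1,2) by (simp add: realizes_def)
  then show "(\<Sum>i\<in>\<beta>' j. block_val (\<alpha> j (G' i)) (H j (G' i)) (f' i)) =
      (\<Sum>i\<in>\<beta> j. block_val (\<alpha> j (G i)) (H j (G i)) (f i))"
    using assms(3-5) j by (intro sum.cong) auto
qed

lemma tuple_Suc:
  "tuple \<alpha> H (Suc k) G \<beta> f =
     tuple \<alpha> H k G \<beta> f @ [\<Sum>i\<in>\<beta> (Suc k). block_val (\<alpha> (Suc k) (G i)) (H (Suc k) (G i)) (f i)]"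
  by (simp add: tuple_def)

text \<open>The chain is prolonged by \<open>G'\<close> at index \<open>n + 1\<close>, and the
  singleton of that index becomes the new last block.\<close>

lemma realizable_append:
  assumes "realizable \<alpha> H k K xs" and G': "G' \<in> Pf NN" "K \<subset> G'" and g: "g \<in> G'"
  shows "realizable \<alpha> H (Suc k) G' (xs @ [block_val (\<alpha> (Suc k) G') (H (Suc k) G') g])"
proof -
  obtain n G \<beta> f where R: "realizes k n G \<beta> f" and K: "G n = K" and xs: "xs = tuple \<alpha> H k G \<beta> f"
    using assms(1) unfolding realizable_def by blast
  let ?G = "G(Suc n := G')" and ?\<beta> = "\<beta>(Suc k := {Suc n})" and ?f = "f(Suc n := g)"
  have "realizes (Suc k) (Suc n) ?G ?\<beta> ?f"
    unfolding realizes_def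
  proof (intro conjI allI ballI impI)
    show "?G i \<in> Pf NN" if "i \<le> Suc n" for i
      using R G' that by (simp add: realizes_def)
    show "?G i \<subset> ?G (Suc i)" if "i < Suc n" for i
      using R G' K that by (cases "i = n") (simp_all add: realizes_def)
    show "?f i \<in> ?G i" if "i \<in> {1..Suc n}" for i
      using R g that by (simp add: realizes_def)
    show Pf: "?\<beta> j \<in> Pf PN" if "j \<in> {1..Suc k}" for j
      using R that by (simp add: realizes_def Pf_def)
    show "?\<beta> j \<subseteq> {1..Suc n}" if "j \<in> {1..Suc k}" for j
    proof (cases "j = Suc k")
      case False
      then have "\<beta> j \<subseteq> {1..n}" using R that by (simp add: realizes_def)
      then show ?thesis using False by auto
    qed simp
    show "set_less (?\<beta> j) (?\<beta> (Suc j))" if j: "j \<in> {1..<Suc k}" for j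
    proof (cases "j = k")
      case True
      then have "\<beta> k \<subseteq> {1..n}" using R j by (simp add: realizes_def)
      then show ?thesis using True j Pf[of j] Pf[of "Suc j"] by (subst set_less_iff) auto
    qed (use R j in \<open>simp add: realizes_def\<close>)
  qed
  moreover have "tuple \<alpha> H k ?G ?\<beta> ?f = xs"
    unfolding xs using R by (intro tuple_cong[of k n]) auto
  then have "xs @ [block_val (\<alpha> (Suc k) G') (H (Suc k) G') g] = tuple \<alpha> H (Suc k) ?G ?\<beta> ?f"
    by (simp add: tuple_Suc)
  ultimately show ?thesis unfolding realizable_def
    by (intro exI[of _ "Suc n"] exI[of _ ?G] exI[of _ ?\<beta>] exI[of _ ?f]) simp
qed

text \<open>Again \<open>G'\<close> gets index \<open>n + 1\<close>, but this index joins the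
  existing last block; it exceeds all indices used so far, so the order of the blocks is
  kept.\<close>

lemma realizable_update:
  assumes "realizable \<alpha> H (Suc k) K (xs @ [x])" and G': "G' \<in> Pf NN" "K \<subset> G'" and g: "g \<in> G'"
  shows "realizable \<alpha> H (Suc k) G' (xs @ [x + block_val (\<alpha> (Suc k) G') (H (Suc k) G') g])"
proof -
  obtain n G \<beta> f where R: "realizes (Suc k) n G \<beta> f" and K: "G n = K"
    and xs: "xs @ [x] = tuple \<alpha> H (Suc k) G \<beta> f"
    using assms(1) unfolding realizable_def by blast
  let ?G = "G(Suc n := G')" and ?\<beta> = "\<beta>(Suc k := insert (Suc n) (\<beta> (Suc k)))" and ?f = "f(Suc n := g)"
  have \<beta>_Pf: "\<beta> j \<in> Pf PN" and \<beta>_sub: "\<beta> j \<subseteq> {1..n}" if "j \<in> {1..Suc k}" for j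
    using R that by (simp_all add: realizes_def)
  have last: "\<beta> (Suc k) \<subseteq> {1..n}" "finite (\<beta> (Suc k))"
    using \<beta>_sub[of "Suc k"] \<beta>_Pf[of "Suc k"] by (auto simp: Pf_def)
  have "realizes (Suc k) (Suc n) ?G ?\<beta> ?f"
    unfolding realizes_def
  proof (intro conjI allI ballI impI)
    show "?G i \<in> Pf NN" if "i \<le> Suc n" for i
      using R G' that by (simp add: realizes_def)
    show "?G i \<subset> ?G (Suc i)" if "i < Suc n" for i
      using R G' K that by (cases "i = n") (simp_all add: realizes_def)
    show "?f i \<in> ?G i" if "i \<in> {1..Suc n}" for i
      using R g that by (simp add: realizes_def)
    show Pf: "?\<beta> j \<in> Pf PN" if "j \<in> {1..Suc k}" for j
      using \<beta>_Pf[OF that] by (auto simp: Pf_def)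
    show "?\<beta> j \<subseteq> {1..Suc n}" if "j \<in> {1..Suc k}" for j
      using \<beta>_sub[OF that] by auto
    show "set_less (?\<beta> j) (?\<beta> (Suc j))" if j: "j \<in> {1..<Suc k}" for j
    proof (cases "j = k")
      case True
      have "set_less (\<beta> k) (\<beta> (Suc k))" using R j True by (simp add: realizes_def)
      then have "\<forall>b\<in>\<beta> k. \<forall>c\<in>\<beta> (Suc k). b < c"
        using set_less_iff[OF \<beta>_Pf \<beta>_Pf, of k "Suc k"] j True by simp
      moreover have "\<beta> k \<subseteq> {1..n}" using \<beta>_sub[of k] j True by simp
      ultimately have "\<forall>b\<in>?\<beta> j. \<forall>c\<in>?\<beta> (Suc j). b < c" using True by auto
      then show ?thesis using set_less_iff[OF Pf Pf, of j "Suc j"] j by simp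
    qed (use R j in \<open>simp add: realizes_def\<close>)
  qed
  moreover have "tuple \<alpha> H k ?G ?\<beta> ?f = xs"
  proof -
    have "tuple \<alpha> H k ?G ?\<beta> ?f = tuple \<alpha> H k G \<beta> f"
      using R by (intro tuple_cong[of "Suc k" n]) auto
    then show ?thesis using xs by (simp add: tuple_Suc)
  qed
  moreover have "(\<Sum>i\<in>?\<beta> (Suc k). block_val (\<alpha> (Suc k) (?G i)) (H (Suc k) (?G i)) (?f i)) =
      x + block_val (\<alpha> (Suc k) G') (H (Suc k) G') g"
  proof -
    have "Suc n \<notin> \<beta> (Suc k)" using last(1) by auto
    then have "(\<Sum>i\<in>?\<beta> (Suc k). block_val (\<alpha> (Suc k) (?G i)) (H (Suc k) (?G i)) (?f i)) =
      block_val (\<alpha> (Suc k) G') (H (Suc k) G') g +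
      (\<Sum>i\<in>\<beta> (Suc k). block_val (\<alpha> (Suc k) (?G i)) (H (Suc k) (?G i)) (?f i))"
      using last(2) by simp
    also have "(\<Sum>i\<in>\<beta> (Suc k). block_val (\<alpha> (Suc k) (?G i)) (H (Suc k) (?G i)) (?f i)) =
      (\<Sum>i\<in>\<beta> (Suc k). block_val (\<alpha> (Suc k) (G i)) (H (Suc k) (G i)) (f i))"
      using \<open>Suc n \<notin> \<beta> (Suc k)\<close> by (intro sum.cong) auto
    also have "\<dots> = x" using xs by (simp add: tuple_Suc)
    finally show ?thesis by simp
  qed
  ultimately show ?thesis unfolding realizable_def
    by (intro exI[of _ "Suc n"] exI[of _ ?G] exI[of _ ?\<beta>] exI[of _ ?f]) (simp add: tuple_Suc)
qed

text \<open>The first member of the chain opens the new coordinate, and every further member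
  increases it.\<close>

lemma realizable_chain_sum:
  assumes "chain_sum (\<alpha> (Suc k)) (H (Suc k)) K L y" "realizable \<alpha> H k K xs"
  shows "realizable \<alpha> H (Suc k) L (xs @ [y])"
  using assms
proof (induction rule: chain_sum.induct)
  case (single G f)
  then show ?case by (blast intro: realizable_append)
next
  case (extend M y G f)
  then show ?case by (blast intro: realizable_update)
qed

text \<open>Every element of the tails of \<open>K\<close> continues a tuple realized with end
  \<open>K\<close>, and these tails belong to the next ultrafilter. The induction peels off one
  quantifier at a time and passes to the end \<open>L\<close> of the longer chain.\<close>

lemma nested_if_realizable:
  assumes full: "\<And>K xs. realizable \<alpha> H m K xs \<Longrightarrow> xs \<in> A"
    and p: "\<And>j. j \<in> {1..m} \<Longrightarrow> ultrafilter_on PN (p j)"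
    and tails: "\<And>j F. j \<in> {1..m} \<Longrightarrow> F \<in> Pf NN \<Longrightarrow> tails (\<alpha> j) (H j) F \<in> p j"
  shows "length xs + d = m \<Longrightarrow> K \<in> Pf NN \<Longrightarrow> realizable \<alpha> H (length xs) K xs \<Longrightarrow> nested p A d xs"
proof (induction d arbitrary: K xs)
  case 0
  then show ?case using full by simp
next
  case (Suc d)
  let ?j = "Suc (length xs)"
  have j: "?j \<in> {1..m}" using Suc.prems by simp
  have "tails (\<alpha> ?j) (H ?j) K \<subseteq> {y \<in> PN. nested p A d (xs @ [y])}"
  proof
    fix y assume y: "y \<in> tails (\<alpha> ?j) (H ?j) K"
    then obtain L where L: "chain_sum (\<alpha> ?j) (H ?j) K L y" by (auto simp: tails_def)
    have "realizable \<alpha> H (length (xs @ [y])) L (xs @ [y])"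
      using realizable_chain_sum[OF L Suc.prems(3)] by simp
    then have "nested p A d (xs @ [y])"
      using Suc.IH[of "xs @ [y]" L] Suc.prems(1) chain_sum_last[OF L] by simp
    moreover have "y \<in> PN" using y tails[OF j Suc.prems(2)] uf_sub[OF p[OF j]] by blast
    ultimately show "y \<in> {y \<in> PN. nested p A d (xs @ [y])}" by simp
  qed
  then have "{y \<in> PN. nested p A d (xs @ [y])} \<in> p ?j"
    using uf_mono[OF p[OF j] tails[OF j Suc.prems(2)]] by blast
  then show ?case by simp
qed

section \<open>The equivalence\<close>

lemma tuple_eq: "tuple \<alpha> H m G \<beta> f =
    map (\<lambda>j. \<Sum>i\<in>\<beta> j. (\<alpha> j (G i) + (\<Sum>t\<in>H j (G i). f i t))) [1..<m + 1]"
  by (simp add: tuple_def block_val_def)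

lemma idempotents_if_block_system:
  assumes m: "1 \<le> m" and A: "A \<subseteq> PN_pow m"
    and \<alpha>H: "\<forall>i \<in> {1..m}. \<alpha> i \<in> Pf NN \<rightarrow> PN \<and> H i \<in> Pf NN \<rightarrow> Pf PN"
    and in_A: "\<forall>n \<ge> m. \<forall>G \<beta> f.
       (\<forall>i \<in> {1..n}. G i \<in> Pf NN) \<and> (\<forall>i \<in> {1..<n}. G i \<subset> G (i + 1)) \<and>
       (\<forall>j \<in> {1..m}. \<beta> j \<in> Pf PN) \<and> (\<forall>j \<in> {1..<m}. set_less (\<beta> j) (\<beta> (j + 1))) \<and>
       Max (\<beta> m) \<le> n \<and> (\<forall>i \<in> {1..n}. f i \<in> G i) \<longrightarrow> tuple \<alpha> H m G \<beta> f \<in> A"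
  shows "\<exists>p. (\<forall>i \<in> {1..m}. p i \<in> J_ultra \<and> uf_idempotent (p i)) \<and> A \<in> tensor p m"
proof -
  have "\<exists>q \<in> J_ultra. uf_idempotent q \<and> (\<forall>F \<in> Pf NN. tails (\<alpha> i) (H i) F \<in> q)"
    if "i \<in> {1..m}" for i
  proof (rule idempotent_tails)
    show "\<alpha> i G \<in> PN \<and> H i G \<in> Pf PN" if "G \<in> Pf NN" for G
      using bspec[OF \<alpha>H \<open>i \<in> {1..m}\<close>] that by blast
  qed
  then have "\<forall>i \<in> {1..m}. \<exists>q. q \<in> J_ultra \<and> uf_idempotent q \<and>
      (\<forall>F \<in> Pf NN. tails (\<alpha> i) (H i) F \<in> q)" by blast
  from bchoice[OF this] obtain p where p: "\<forall>i \<in> {1..m}. p i \<in> J_ultra \<and> uf_idempotent (p i) \<and>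
      (\<forall>F \<in> Pf NN. tails (\<alpha> i) (H i) F \<in> p i)" by (rule exE)
  have "xs \<in> A" if real: "realizable \<alpha> H m K xs" for K xs
  proof -
    obtain n G \<beta> f where R: "realizes m n G \<beta> f" and xs: "xs = tuple \<alpha> H m G \<beta> f"
      using real unfolding realizable_def by blast
    have \<beta>: "\<beta> j \<in> Pf PN" "\<beta> j \<subseteq> {1..n}" if "j \<in> {1..m}" for j
      using R that by (simp_all add: realizes_def)
    have less: "set_less (\<beta> j) (\<beta> (Suc j))" if "j \<in> {1..<m}" for j
      using R that by (simp add: realizes_def)
    \<comment> \<open>The hypothesis on blocks asks for \<open>n \<ge> m\<close>. This holds because
      \<open>m\<close> successive blocks of positive integers force \<open>Max (\<beta> m)\<close>
      to be at least \<open>m\<close>.\<close>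
    have ge: "j \<le> m \<Longrightarrow> 1 \<le> j \<Longrightarrow> j \<le> Max (\<beta> j)" for j
    proof (induction j)
      case (Suc j)
      have Max: "Max (\<beta> (Suc j)) \<in> \<beta> (Suc j)" using \<beta>(1)[of "Suc j"] Suc.prems by (simp add: Pf_def)
      show ?case
      proof (cases "j = 0")
        case True
        then show ?thesis using Max \<beta>(2)[of "Suc j"] Suc.prems by force
      next
        case False
        then have "j \<le> Max (\<beta> j)" using Suc by simp
        also have "\<dots> < Min (\<beta> (Suc j))"
          using less[of j] Suc.prems False by (simp add: set_less_def)
        also have "\<dots> \<le> Max (\<beta> (Suc j))"
          using Max \<beta>(1)[of "Suc j"] Suc.prems by (simp add: Pf_def)
        finally show ?thesis by simp
      qed
    qed simp
    have "Max (\<beta> m) \<in> \<beta> m" using \<beta>(1)[of m] m by (simp add: Pf_def)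
    then have Max: "Max (\<beta> m) \<le> n" using \<beta>(2)[of m] m by force
    show ?thesis unfolding xs
    proof (rule in_A[THEN spec[of _ n], THEN mp, THEN spec, THEN spec, THEN spec, THEN mp], goal_cases)
      case 1
      show ?case using ge[of m] m Max by simp
    next
      case 2
      show ?case using R Max by (simp add: realizes_def)
    qed
  qed
  moreover obtain K where K: "K \<in> Pf NN"
  proof -
    obtain g where "g \<in> NN" using infinite_NN by (meson finite.emptyI finite_subset subsetI)
    then have "{g} \<in> Pf NN" by (intro PfI) auto
    then show thesis by (rule that)
  qed
  moreover have "realizable \<alpha> H (length []) K []" using realizable_Nil[OF K] by simp
  ultimately have "nested p A m []"
    using p J_ultraD by (intro nested_if_realizable[of \<alpha> H m A p "[]" m K]) auto
  moreover obtain k where k: "m = Suc k" using m by (cases m) auto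
  ultimately have "A \<in> tensor p m" using tensor_iff_nested[of A k p] A by simp
  then show ?thesis using p by blast
qed

lemma block_system_if_idempotents:
  assumes m: "1 \<le> m" and A: "A \<subseteq> PN_pow m"
    and p: "\<And>i. i \<in> {1..m} \<Longrightarrow> p i \<in> J_ultra" "\<And>i. i \<in> {1..m} \<Longrightarrow> uf_idempotent (p i)"
    and tensor: "A \<in> tensor p m"
  shows "\<exists>\<alpha> H. (\<forall>i \<in> {1..m}. \<alpha> i \<in> Pf NN \<rightarrow> PN \<and> H i \<in> Pf NN \<rightarrow> Pf PN) \<and>
    (\<forall>F \<in> Pf NN. \<forall>G \<in> Pf NN. F \<subset> G \<longrightarrow> (\<forall>i \<in> {1..m}. Max (H i F) < Min (H i G))) \<and>
    (\<forall>n \<ge> m. \<forall>G \<beta> f.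
       (\<forall>i \<in> {1..n}. G i \<in> Pf NN) \<and> (\<forall>i \<in> {1..<n}. G i \<subset> G (i + 1)) \<and>
       (\<forall>j \<in> {1..m}. \<beta> j \<in> Pf PN) \<and> (\<forall>j \<in> {1..<m}. set_less (\<beta> j) (\<beta> (j + 1))) \<and>
       Max (\<beta> m) \<le> n \<and> (\<forall>i \<in> {1..n}. f i \<in> G i) \<longrightarrow> tuple \<alpha> H m G \<beta> f \<in> A)"
proof -
  have uf: "ultrafilter_on PN (p j)" if "j \<in> {1..m}" for j using J_ultraD[OF p(1)[OF that]] .
  \<comment> \<open>The admissible next entries after \<open>xs\<close>, judged by most of the
    remaining continuations.\<close>
  define sec where "sec xs = {y \<in> PN. nested p A (m - Suc (length xs)) (xs @ [y])}" for xs
  \<comment> \<open>With the last entry in the star set both moves can be repeated: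
    \<open>star_mem\<close> provides new entries and \<open>shift_star_mem\<close> provides
    increments, which leave \<open>butlast xs\<close> and hence the section unchanged.\<close>
  define Good where "Good = {xs. length xs \<le> m \<and> (xs = [] \<or>
    sec (butlast xs) \<in> p (length xs) \<and> last xs \<in> star (p (length xs)) (sec (butlast xs)))}"
  obtain k where k: "m = Suc k" using m by (cases m) auto
  have nested: "nested p A (m - length xs) xs" if "xs \<in> Good" for xs
  proof (cases xs rule: rev_cases)
    case Nil
    then show ?thesis using tensor_iff_nested[of A k p] A tensor k by simp
  next
    case (snoc ys y)
    then have "y \<in> sec ys" using that by (simp add: Good_def star_def)
    then show ?thesis by (simp add: sec_def snoc)
  qed
  have app: "{z \<in> PN. xs @ [z] \<in> Good} \<in> p (Suc (length xs))"
    if xs: "xs \<in> Good" "length xs < m" for xs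
  proof -
    have j: "Suc (length xs) \<in> {1..m}" using xs by simp
    have "m - length xs = Suc (m - Suc (length xs))" using xs by simp
    then have sec: "sec xs \<in> p (Suc (length xs))" using nested[OF xs(1)] by (simp add: sec_def)
    have "{z \<in> PN. xs @ [z] \<in> Good} = star (p (Suc (length xs))) (sec xs)"
      using sec xs by (auto simp: Good_def star_def sec_def)
    then show ?thesis using star_mem[OF uf[OF j] p(2)[OF j] sec] by simp
  qed
  have upd: "{z \<in> PN. butlast xs @ [last xs + z] \<in> Good} \<in> p (length xs)"
    if xs: "xs \<in> Good" "xs \<noteq> []" "length xs \<le> m" for xs
  proof -
    have j: "length xs \<in> {1..m}" using xs by (simp add: Suc_le_eq)
    have "{z \<in> PN. butlast xs @ [last xs + z] \<in> Good} =
        shift (last xs) (star (p (length xs)) (sec (butlast xs)))"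
      using xs by (auto simp: Good_def)
    then show ?thesis using shift_star_mem[OF uf[OF j] p(2)[OF j]] xs by (simp add: Good_def)
  qed
  have Nil: "[] \<in> Good" by (simp add: Good_def)
  have "\<exists>\<alpha> H V. \<forall>F \<in> Pf NN.
    (\<forall>j \<in> {1..m}. \<alpha> F j \<in> PN \<and> H F j \<in> Pf PN \<and> (\<forall>F' \<in> preds F. Max (H F' j) < Min (H F j))) \<and>
    V F \<subseteq> Good \<and>
    (\<forall>xs \<in> insert [] (\<Union> (V ` preds F)). \<forall>f \<in> F. moves m (\<alpha> F) (H F) f xs \<subseteq> V F)"
    by (rule exists_block_system) (fact p(1) Nil app upd)+
  then obtain \<alpha> H V where sys: "\<forall>F \<in> Pf NN.
    (\<forall>j \<in> {1..m}. \<alpha> F j \<in> PN \<and> H F j \<in> Pf PN \<and> (\<forall>F' \<in> preds F. Max (H F' j) < Min (H F j))) \<and>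
    V F \<subseteq> Good \<and>
    (\<forall>xs \<in> insert [] (\<Union> (V ` preds F)). \<forall>f \<in> F. moves m (\<alpha> F) (H F) f xs \<subseteq> V F)"
    by (elim exE)
  \<comment> \<open>The recursion runs over \<open>F\<close> and yields all coordinates at once;
    here the coordinate index is moved to the front.\<close>
  define \<alpha>' H' where "\<alpha>' j F = \<alpha> F j" and "H' j F = H F j" for j F
  have tuple: "tuple \<alpha>' H' m G \<beta> f \<in> A"
    if "\<forall>i \<in> {1..n}. G i \<in> Pf NN" "\<forall>i \<in> {1..<n}. G i \<subset> G (i + 1)" "\<forall>j \<in> {1..m}. \<beta> j \<in> Pf PN"
      "\<forall>j \<in> {1..<m}. set_less (\<beta> j) (\<beta> (j + 1))" "Max (\<beta> m) \<le> n" "\<forall>i \<in> {1..n}. f i \<in> G i"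
    for n G \<beta> f
  proof -
    have "tuple \<alpha>' H' m G \<beta> f \<in> V (G (Max (\<beta> m)))"
      unfolding tuple_def \<alpha>'_def H'_def
    proof (rule block_lists_in_V[where n = n and m = m])
      show "moves m (\<alpha> F) (H F) g xs \<subseteq> V F"
        if "F \<in> Pf NN" "xs \<in> insert [] (\<Union> (V ` preds F))" "g \<in> F" for F xs g
        using sys that by blast
    qed (use that m in auto)
    moreover have "Max (\<beta> m) \<in> \<beta> m" "\<beta> m \<subseteq> PN" using that(3) m by (simp_all add: Pf_def)
    then have "Max (\<beta> m) \<in> {1..n}" using that(5) by force
    then have "V (G (Max (\<beta> m))) \<subseteq> Good" using sys that(1) by blast
    ultimately have "tuple \<alpha>' H' m G \<beta> f \<in> Good" by blast
    \<comment> \<open>At full length \<open>m\<close> no quantifier is left, and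
      \<open>nested\<close> is membership in \<open>A\<close>.\<close>
    from nested[OF this] show ?thesis by (simp add: tuple_def)
  qed
  have less: "Max (H' i F) < Min (H' i G)"
    if "F \<in> Pf NN" "G \<in> Pf NN" "F \<subset> G" "i \<in> {1..m}" for F G i
    using sys that by (simp add: H'_def preds_def)
  have types: "\<alpha>' i \<in> Pf NN \<rightarrow> PN \<and> H' i \<in> Pf NN \<rightarrow> Pf PN" if "i \<in> {1..m}" for i
    using sys that by (simp add: \<alpha>'_def H'_def Pi_def)
  show ?thesis
  proof (intro exI[of _ \<alpha>'] exI[of _ H'] conjI ballI allI impI)
    show "\<alpha>' i \<in> Pf NN \<rightarrow> PN" "H' i \<in> Pf NN \<rightarrow> Pf PN" if "i \<in> {1..m}" for i
      using types[OF that] by simp_all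
  qed ((elim conjE)?, (rule less, assumption+ | rule tuple, assumption+))+
qed

theorem theorem1p25:
  fixes m :: nat and A :: "nat list set"
  assumes "1 \<le> m" and "A \<subseteq> PN_pow m"
  shows
    "(\<exists>(\<alpha> :: nat \<Rightarrow> (nat \<Rightarrow> nat) set \<Rightarrow> nat) (H :: nat \<Rightarrow> (nat \<Rightarrow> nat) set \<Rightarrow> nat set).
        (\<forall>i \<in> {1..m}. \<alpha> i \<in> Pf NN \<rightarrow> PN \<and> H i \<in> Pf NN \<rightarrow> Pf PN) \<and>
        (\<forall>F \<in> Pf NN. \<forall>G \<in> Pf NN. F \<subset> G \<longrightarrow>
           (\<forall>i \<in> {1..m}. Max (H i F) < Min (H i G))) \<and>
        (\<forall>n \<ge> m. \<forall>(G :: nat \<Rightarrow> (nat \<Rightarrow> nat) set) (\<beta> :: nat \<Rightarrow> nat set) (f :: nat \<Rightarrow> nat \<Rightarrow> nat).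
           (\<forall>i \<in> {1..n}. G i \<in> Pf NN) \<and>
           (\<forall>i \<in> {1..<n}. G i \<subset> G (i + 1)) \<and>
           (\<forall>j \<in> {1..m}. \<beta> j \<in> Pf PN) \<and>
           (\<forall>j \<in> {1..<m}. set_less (\<beta> j) (\<beta> (j + 1))) \<and>
           Max (\<beta> m) \<le> n \<and>
           (\<forall>i \<in> {1..n}. f i \<in> G i) \<longrightarrow>
           map (\<lambda>j. \<Sum>i\<in>\<beta> j. (\<alpha> j (G i) + (\<Sum>t\<in>H j (G i). f i t))) [1..<m + 1] \<in> A))
     \<longleftrightarrow>
     (\<exists>p :: nat \<Rightarrow> nat set set.
        (\<forall>i \<in> {1..m}. p i \<in> J_ultra \<and> uf_idempotent (p i)) \<and>
        A \<in> tensor p m)"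
  unfolding tuple_eq[symmetric]
proof (rule iffI, goal_cases)
  case 1
  then obtain \<alpha> H where \<alpha>H: "\<forall>i \<in> {1..m}. \<alpha> i \<in> Pf NN \<rightarrow> PN \<and> H i \<in> Pf NN \<rightarrow> Pf PN"
    and in_A: "\<forall>n \<ge> m. \<forall>G \<beta> f.
       (\<forall>i \<in> {1..n}. G i \<in> Pf NN) \<and> (\<forall>i \<in> {1..<n}. G i \<subset> G (i + 1)) \<and>
       (\<forall>j \<in> {1..m}. \<beta> j \<in> Pf PN) \<and> (\<forall>j \<in> {1..<m}. set_less (\<beta> j) (\<beta> (j + 1))) \<and>
       Max (\<beta> m) \<le> n \<and> (\<forall>i \<in> {1..n}. f i \<in> G i) \<longrightarrow> tuple \<alpha> H m G \<beta> f \<in> A"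
    by (elim exE conjE)
  show ?case by (rule idempotents_if_block_system[OF assms \<alpha>H in_A])
next
  case 2
  then obtain p where "\<forall>i \<in> {1..m}. p i \<in> J_ultra \<and> uf_idempotent (p i)" "A \<in> tensor p m"
    by (elim exE conjE)
  then show ?case by (intro block_system_if_idempotents[OF assms]) simp_all
qed

end
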